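(* Let $C$ be a commutative unital ring, $G$ a semigroup (with zero), and $S$ the set of all nonzero $\sim$-equivalence classes of $G$. Then the following hold. (1) There is a minimal $C$-linear trace $t : \overline{CG} \to C^{(S)}$. (2) If $R$ is a $C$-algebra, and $t: \overline{CG} \to R$ is a $C$-linear trace, then $t$ is minimal if and only if for all $g_1, \dots, g_n \in G$ such that $[g_1], \dots, [g_n] \in S$ are distinct, $t(g_1), \dots, t(g_n)$ are $C$-linearly independent in $R$. (3) There is a normalized minimal $C$-linear trace $t : \overline{CG} \to R$ for some unital $C$-algebra $R$ if and only if $|S| \leq 1$.
   Context: Rings are associative but not necessarily unital. Unital commutative rings $C$ are taken to satisfy $1\neq 0$, and $1\in C$ acts as the identity on $C$-algebras. "Semigroup" means a semigroup with zero. $\overline{CG}$ is the contracted semigroup ring, i.e., the semigroup ring $CG$ with the zero of $G$ identified with the zero of the ring; its elements are $\sum_g a_g g$ with $g$ ranging over the nonzero elements of $G$, $a_g\in C$, almost all zero. An element $g\in G$ is identified with $1\cdot g \in \overline{CG}$. For $g,h\in G$, write $g\sim h$ if either $g=h$ or there are $a_1,b_1,\dots,a_n,b_n\in G$ such that $g=a_1b_1$, $b_1a_1=a_2b_2$, $b_2a_2=a_3b_3$, $\dots$, $b_{n-1}a_{n-1}=a_nb_n$, $b_na_n=h$. This is an equivalence relation; $[g]$ denotes the class of $g$. The nonzero classes are the classes different from $[0]$. $C^{(S)}$ is the direct sum of copies of $C$ indexed by $S$ (the zero ring if $S=\emptyset$). For rings $A,T$, a trace $t:A\to T$ is a map with $t(x+y)=t(x)+t(y)$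 and $t(xy)=t(yx)$ for all $x,y\in A$; it is $C$-linear (for $C$-algebras $A,T$) if $t(cx)=ct(x)$ for all $c\in C$, $x\in A$. It is minimal if for all $x\in A$, $t(x)=0$ implies $x\in[A,A]$, where $[A,A]$ is the additive subgroup of $A$ generated by all commutators $xy-yx$. A $C$-linear trace $t:\overline{CG}\to R$ with $R$ unital is normalized if $t(g)\in\{0,1\}$ for all $g\in G$. Elements $x_1,\dots,x_n$ of a $C$-algebra are $C$-linearly independent (as a family) if $c_1x_1+\dots+c_nx_n=0$ with $c_i\in C$ implies $c_1=\dots=c_n=0$. *)

theory Defs
  imports "HOL-Algebra.Algebra"
begin

section \<open>Algebras and traces\<close>

text \<open>An algebra over a commutative unital ring, neither commutative nor unital in general.
  It is carried by the library's \<^type>\<open>module\<close> record, whose field for the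
  multiplicative identity is left unconstrained. A unital algebra is one that is in addition
  a \<^locale>\<open>ring\<close>; the zero ring is not excluded.\<close>

locale assoc_algebra = module C A for C and A (structure) +
  assumes m_closed: "\<lbrakk>x \<in> carrier A; y \<in> carrier A\<rbrakk> \<Longrightarrow> x \<otimes> y \<in> carrier A"
    and m_assoc: "\<lbrakk>x \<in> carrier A; y \<in> carrier A; z \<in> carrier A\<rbrakk>
      \<Longrightarrow> (x \<otimes> y) \<otimes> z = x \<otimes> (y \<otimes> z)"
    and l_distr: "\<lbrakk>x \<in> carrier A; y \<in> carrier A; z \<in> carrier A\<rbrakk>
      \<Longrightarrow> (x \<oplus> y) \<otimes> z = x \<otimes> z \<oplus> y \<otimes> z"
    and r_distr: "\<lbrakk>x \<in> carrier A; y \<in> carrier A; z \<in> carrier A\<rbrakk>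
      \<Longrightarrow> z \<otimes> (x \<oplus> y) = z \<otimes> x \<oplus> z \<otimes> y"
    and smult_mult_left: "\<lbrakk>c \<in> carrier C; x \<in> carrier A; y \<in> carrier A\<rbrakk>
      \<Longrightarrow> (c \<odot> x) \<otimes> y = c \<odot> (x \<otimes> y)"
    and smult_mult_right: "\<lbrakk>c \<in> carrier C; x \<in> carrier A; y \<in> carrier A\<rbrakk>
      \<Longrightarrow> x \<otimes> (c \<odot> y) = c \<odot> (x \<otimes> y)"

definition unital_algebra :: "'c ring \<Rightarrow> ('c, 'a) module \<Rightarrow> bool" where
  "unital_algebra C A \<longleftrightarrow> assoc_algebra C A \<and> ring A"

definition is_trace :: "('c, 'a) module \<Rightarrow> ('c, 'b) module \<Rightarrow> ('a \<Rightarrow> 'b) \<Rightarrow> bool" where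
  "is_trace A T t \<longleftrightarrow>
     t \<in> carrier A \<rightarrow> carrier T \<and>
     (\<forall>x\<in>carrier A. \<forall>y\<in>carrier A. t (x \<oplus>\<^bsub>A\<^esub> y) = t x \<oplus>\<^bsub>T\<^esub> t y) \<and>
     (\<forall>x\<in>carrier A. \<forall>y\<in>carrier A. t (x \<otimes>\<^bsub>A\<^esub> y) = t (y \<otimes>\<^bsub>A\<^esub> x))"

definition linear_trace ::
  "'c ring \<Rightarrow> ('c, 'a) module \<Rightarrow> ('c, 'b) module \<Rightarrow> ('a \<Rightarrow> 'b) \<Rightarrow> bool" where
  "linear_trace C A T t \<longleftrightarrow>
     is_trace A T t \<and>
     (\<forall>c\<in>carrier C. \<forall>x\<in>carrier A. t (c \<odot>\<^bsub>A\<^esub> x) = c \<odot>\<^bsub>T\<^esub> t x)"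

definition commutator_subgroup :: "('c, 'a) module \<Rightarrow> 'a set" where
  "commutator_subgroup A = generate (add_monoid A)
     {x \<otimes>\<^bsub>A\<^esub> y \<ominus>\<^bsub>A\<^esub> y \<otimes>\<^bsub>A\<^esub> x | x y. x \<in> carrier A \<and> y \<in> carrier A}"

definition minimal_trace :: "('c, 'a) module \<Rightarrow> ('c, 'b) module \<Rightarrow> ('a \<Rightarrow> 'b) \<Rightarrow> bool" where
  "minimal_trace A T t \<longleftrightarrow>
     is_trace A T t \<and> (\<forall>x\<in>carrier A. t x = \<zero>\<^bsub>T\<^esub> \<longrightarrow> x \<in> commutator_subgroup A)"

definition lin_indep_family ::
  "'c ring \<Rightarrow> ('c, 'a) module \<Rightarrow> 'i set \<Rightarrow> ('i \<Rightarrow> 'a) \<Rightarrow> bool" where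
  "lin_indep_family C A I x \<longleftrightarrow>
     (\<forall>c \<in> I \<rightarrow> carrier C. (\<Oplus>\<^bsub>A\<^esub>i\<in>I. c i \<odot>\<^bsub>A\<^esub> x i) = \<zero>\<^bsub>A\<^esub> \<longrightarrow> (\<forall>i\<in>I. c i = \<zero>\<^bsub>C\<^esub>))"

text \<open>Elements of a direct sum of copies of \<open>C\<close> are finitely supported functions, set to
  zero outside the index set so that equality of elements is equality of functions. Direct sums
  have componentwise multiplication and, for infinite index sets, no identity.\<close>

definition direct_sum_copies :: "'c ring \<Rightarrow> 's set \<Rightarrow> ('c, 's \<Rightarrow> 'c) module" where
  "direct_sum_copies C S =
     \<lparr>carrier = {f. (\<forall>s\<in>S. f s \<in> carrier C) \<and> (\<forall>s. s \<notin> S \<longrightarrow> f s = \<zero>\<^bsub>C\<^esub>) \<and>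
                    finite {s. f s \<noteq> \<zero>\<^bsub>C\<^esub>}},
      monoid.mult = (\<lambda>f h s. f s \<otimes>\<^bsub>C\<^esub> h s),
      one = undefined,
      ring.zero = (\<lambda>s. \<zero>\<^bsub>C\<^esub>),
      add = (\<lambda>f h s. f s \<oplus>\<^bsub>C\<^esub> h s),
      smult = (\<lambda>c f s. c \<otimes>\<^bsub>C\<^esub> f s)\<rparr>"


section \<open>Semigroups with zero\<close>

record 'g zero_semigroup = "'g partial_object" +
  sg_mult :: "'g \<Rightarrow> 'g \<Rightarrow> 'g" (infixl \<open>\<cdot>\<index>\<close> 70)
  sg_zero :: 'g

locale semigroup_with_zero =
  fixes G :: "'g zero_semigroup" (structure)
  assumes sg_closed: "\<lbrakk>a \<in> carrier G; b \<in> carrier G\<rbrakk> \<Longrightarrow> a \<cdot> b \<in> carrier G"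
    and sg_assoc: "\<lbrakk>a \<in> carrier G; b \<in> carrier G; c \<in> carrier G\<rbrakk>
      \<Longrightarrow> (a \<cdot> b) \<cdot> c = a \<cdot> (b \<cdot> c)"
    and sg_zero_closed: "sg_zero G \<in> carrier G"
    and sg_zero_left: "a \<in> carrier G \<Longrightarrow> sg_zero G \<cdot> a = sg_zero G"
    and sg_zero_right: "a \<in> carrier G \<Longrightarrow> a \<cdot> sg_zero G = sg_zero G"

definition swap_step :: "'g zero_semigroup \<Rightarrow> ('g \<times> 'g) set" where
  "swap_step G = {(a \<cdot>\<^bsub>G\<^esub> b, b \<cdot>\<^bsub>G\<^esub> a) | a b. a \<in> carrier G \<and> b \<in> carrier G}"

definition sim :: "'g zero_semigroup \<Rightarrow> ('g \<times> 'g) set" where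
  "sim G = {(g, h). g \<in> carrier G \<and> h \<in> carrier G \<and> (g, h) \<in> (swap_step G)\<^sup>*}"

definition sim_class :: "'g zero_semigroup \<Rightarrow> 'g \<Rightarrow> 'g set" where
  "sim_class G g = sim G `` {g}"

definition nonzero_classes :: "'g zero_semigroup \<Rightarrow> 'g set set" where
  "nonzero_classes G = carrier G // sim G - {sim_class G (sg_zero G)}"


section \<open>The contracted semigroup ring\<close>

text \<open>Elements are coefficient functions supported on finitely many nonzero elements of \<open>G\<close>.
  In a product, the contributions of the pairs \<open>(a, b)\<close> with \<open>a b\<close> the zero of \<open>G\<close> are
  dropped. The sum defining a product runs over supports, as a \<^const>\<open>finsum\<close> over an
  infinite set would be meaningless.\<close>

definition contracted_ring :: "'c ring \<Rightarrow> 'g zero_semigroup \<Rightarrow> ('c, 'g \<Rightarrow> 'c) module" where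
  "contracted_ring C G =
     (direct_sum_copies C (carrier G - {sg_zero G}))
       \<lparr>monoid.mult := (\<lambda>f h g. if g = sg_zero G then \<zero>\<^bsub>C\<^esub>
          else \<Oplus>\<^bsub>C\<^esub>p\<in>{(a, b). f a \<noteq> \<zero>\<^bsub>C\<^esub> \<and> h b \<noteq> \<zero>\<^bsub>C\<^esub> \<and> a \<cdot>\<^bsub>G\<^esub> b = g}.
                 f (fst p) \<otimes>\<^bsub>C\<^esub> h (snd p))\<rparr>"

definition sg_elem :: "'c ring \<Rightarrow> 'g zero_semigroup \<Rightarrow> 'g \<Rightarrow> ('g \<Rightarrow> 'c)" where
  "sg_elem C G g = (\<lambda>h. if h = g \<and> g \<noteq> sg_zero G then \<one>\<^bsub>C\<^esub> else \<zero>\<^bsub>C\<^esub>)"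

definition normalized_trace ::
  "'c ring \<Rightarrow> 'g zero_semigroup \<Rightarrow> ('c, 'r) module \<Rightarrow> (('g \<Rightarrow> 'c) \<Rightarrow> 'r) \<Rightarrow> bool" where
  "normalized_trace C G R t \<longleftrightarrow>
     linear_trace C (contracted_ring C G) R t \<and>
     (\<forall>g\<in>carrier G. t (sg_elem C G g) \<in> {\<zero>\<^bsub>R\<^esub>, \<one>\<^bsub>R\<^esub>})"

text \<open>A formula cannot quantify over all carrier types of \<open>R\<close>. Whenever some \<open>R\<close> admits such a
  trace, one carried by the type of \<open>C\<close> does, so existence may be stated there; a condition
  necessary for existence has to be stated for an arbitrary carrier type.\<close>

definition normalized_minimal_trace ::
  "'c ring \<Rightarrow> 'g zero_semigroup \<Rightarrow> ('c, 'r) module \<Rightarrow> (('g \<Rightarrow> 'c) \<Rightarrow> 'r) \<Rightarrow> bool" where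
  "normalized_minimal_trace C G R t \<longleftrightarrow>
     unital_algebra C R \<and> normalized_trace C G R t \<and> minimal_trace (contracted_ring C G) R t"


section \<open>Well-definedness\<close>

lemma (in semigroup_with_zero) equiv_sim: "equiv (carrier G) (sim G)"
proof -
  have "sym ((swap_step G)\<^sup>*)"
    by (rule sym_rtrancl) (auto simp: sym_def swap_step_def)
  then have "sym (sim G)"
    by (auto simp: sim_def sym_def)
  moreover have "refl_on (carrier G) (sim G)" "trans (sim G)" "sim G \<subseteq> carrier G \<times> carrier G"
    by (auto simp: sim_def refl_on_def trans_def)
  ultimately show ?thesis
    by (simp add: equiv_def)
qed

lemma assoc_algebra_direct_sum_copies:
  assumes "cring C"
  shows "assoc_algebra C (direct_sum_copies C S)"
proof -
  interpret C: cring C by fact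
  let ?D = "direct_sum_copies C S"
  have car: "f s \<in> carrier C" if "f \<in> carrier ?D" for f s
    using that by (cases "s \<in> S") (auto simp: direct_sum_copies_def)
  have fin: "finite {s. f s \<noteq> \<zero>\<^bsub>C\<^esub>}" if "f \<in> carrier ?D" for f
    using that by (auto simp: direct_sum_copies_def)
  have carI: "f \<in> carrier ?D"
    if "\<And>s. f s \<in> carrier C" "\<And>s. s \<notin> S \<Longrightarrow> f s = \<zero>\<^bsub>C\<^esub>" "{s. f s \<noteq> \<zero>\<^bsub>C\<^esub>} \<subseteq> T" "finite T"
    for f :: "'b \<Rightarrow> 'a" and T
    using that by (auto simp: direct_sum_copies_def intro: finite_subset)
  have out: "f s = \<zero>\<^bsub>C\<^esub>" if "f \<in> carrier ?D" "s \<notin> S" for f s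
    using that by (auto simp: direct_sum_copies_def)
  have add: "x \<oplus>\<^bsub>?D\<^esub> y = (\<lambda>s. x s \<oplus>\<^bsub>C\<^esub> y s)" 
   and mul: "x \<otimes>\<^bsub>?D\<^esub> y = (\<lambda>s. x s \<otimes>\<^bsub>C\<^esub> y s)" 
   and sm: "c \<odot>\<^bsub>?D\<^esub> y = (\<lambda>s. c \<otimes>\<^bsub>C\<^esub> y s)" 
   and ze: "\<zero>\<^bsub>?D\<^esub> = (\<lambda>s. \<zero>\<^bsub>C\<^esub>)" for x y c
    by (simp_all add: direct_sum_copies_def)
  have addc: "x \<oplus>\<^bsub>?D\<^esub> y \<in> carrier ?D" if "x \<in> carrier ?D" "y \<in> carrier ?D" for x y
    unfolding add
    by (rule carI[of _ "{s. x s \<noteq> \<zero>\<^bsub>C\<^esub>} \<union> {s. y s \<noteq> \<zero>\<^bsub>C\<^esub>}"]) (use that in \<open>auto simp: car fin out\<close>)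
  have mulc: "x \<otimes>\<^bsub>?D\<^esub> y \<in> carrier ?D" if "x \<in> carrier ?D" "y \<in> carrier ?D" for x y
    unfolding mul
    by (rule carI[of _ "{s. x s \<noteq> \<zero>\<^bsub>C\<^esub>}"]) (use that in \<open>auto simp: car fin out\<close>)
  have smc: "c \<odot>\<^bsub>?D\<^esub> y \<in> carrier ?D" if "c \<in> carrier C" "y \<in> carrier ?D" for c y
    unfolding sm
    by (rule carI[of _ "{s. y s \<noteq> \<zero>\<^bsub>C\<^esub>}"]) (use that in \<open>auto simp: car fin out\<close>)
  have ag: "abelian_group ?D"
  proof (rule abelian_groupI)
    show "\<zero>\<^bsub>?D\<^esub> \<in> carrier ?D"
      by (simp add: ze) (rule carI[of _ "{}"], auto)
    fix x assume x: "x \<in> carrier ?D"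
    have "(\<lambda>s. \<ominus>\<^bsub>C\<^esub> x s) \<in> carrier ?D"
      by (rule carI[of _ "{s. x s \<noteq> \<zero>\<^bsub>C\<^esub>}"]) (use x in \<open>auto simp: car fin out\<close>)
    moreover have "(\<lambda>s. \<ominus>\<^bsub>C\<^esub> x s) \<oplus>\<^bsub>?D\<^esub> x = \<zero>\<^bsub>?D\<^esub>"
      using x by (auto simp: add ze car C.l_neg)
    ultimately show "\<exists>y\<in>carrier ?D. y \<oplus>\<^bsub>?D\<^esub> x = \<zero>\<^bsub>?D\<^esub>" by blast
  qed (auto simp: addc, auto simp: add ze car C.a_assoc intro!: ext C.a_comm)
  have "module C ?D"
    by (rule moduleI[OF assms ag]) (auto simp: smc, auto simp: add sm car C.l_distr C.r_distr C.m_assoc)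
  then show ?thesis
    by (intro assoc_algebra.intro assoc_algebra_axioms.intro)
      (auto simp: mulc, auto simp: mul add sm car C.l_distr C.r_distr C.m_ac)
qed


lemma (in abelian_monoid) finsum_Times:
  assumes "finite I" "finite J" "\<And>i j. i \<in> I \<Longrightarrow> j \<in> J \<Longrightarrow> f i j \<in> carrier G"
  shows "(\<Oplus>p\<in>I \<times> J. f (fst p) (snd p)) = (\<Oplus>i\<in>I. \<Oplus>j\<in>J. f i j)"
  using assms(1,3)
proof (induction I)
  case empty
  then show ?case by simp
next
  case (insert i I)
  have *: "insert i I \<times> J = Pair i ` J \<union> I \<times> J" by auto
  have "(\<Oplus>p\<in>insert i I \<times> J. f (fst p) (snd p)) =
     (\<Oplus>p\<in>Pair i ` J. f (fst p) (snd p)) \<oplus> (\<Oplus>p\<in>I \<times> J. f (fst p) (snd p))"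
    unfolding * by (rule finsum_Un_disjoint) (use insert assms(2) in auto)
  also have "(\<Oplus>p\<in>Pair i ` J. f (fst p) (snd p)) = (\<Oplus>j\<in>J. f i j)"
    using insert by (subst finsum_reindex) (auto simp: inj_on_def)
  finally show ?case
    using insert by simp
qed

lemma (in abelian_monoid) finsum_swap:
  assumes "finite I" "finite J" "\<And>i j. i \<in> I \<Longrightarrow> j \<in> J \<Longrightarrow> f i j \<in> carrier G"
  shows "(\<Oplus>i\<in>I. \<Oplus>j\<in>J. f i j) = (\<Oplus>j\<in>J. \<Oplus>i\<in>I. f i j)"
  using assms(1,3)
proof (induction I)
  case empty
  then show ?case by simp
next
  case (insert i I)
  then have "(\<Oplus>j\<in>J. \<Oplus>i\<in>insert i I. f i j) = (\<Oplus>j\<in>J. f i j \<oplus> (\<Oplus>i\<in>I. f i j))"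
    by (intro finsum_cong') auto
  then show ?case
    using insert by (simp add: finsum_addf Pi_def)
qed

lemma (in abelian_monoid) finsum2_cong:
  assumes "\<And>i j. i \<in> I \<Longrightarrow> j \<in> J \<Longrightarrow> f i j = h i j" "\<And>i j. i \<in> I \<Longrightarrow> j \<in> J \<Longrightarrow> h i j \<in> carrier G"
  shows "(\<Oplus>i\<in>I. \<Oplus>j\<in>J. f i j) = (\<Oplus>i\<in>I. \<Oplus>j\<in>J. h i j)"
  using assms by (intro finsum_cong') (auto intro!: finsum_cong' finsum_closed)

lemma (in abelian_monoid) finsum2_addf:
  assumes "\<And>i j. i \<in> I \<Longrightarrow> j \<in> J \<Longrightarrow> f i j \<in> carrier G" "\<And>i j. i \<in> I \<Longrightarrow> j \<in> J \<Longrightarrow> h i j \<in> carrier G"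
  shows "(\<Oplus>i\<in>I. \<Oplus>j\<in>J. f i j) \<oplus> (\<Oplus>i\<in>I. \<Oplus>j\<in>J. h i j) = (\<Oplus>i\<in>I. \<Oplus>j\<in>J. f i j \<oplus> h i j)"
proof -
  have "(\<Oplus>i\<in>I. \<Oplus>j\<in>J. f i j \<oplus> h i j) = (\<Oplus>i\<in>I. (\<Oplus>j\<in>J. f i j) \<oplus> (\<Oplus>j\<in>J. h i j))"
    using assms by (intro finsum_cong' finsum_addf) auto
  then show ?thesis
    using assms by (simp add: finsum_addf)
qed

context semigroup_with_zero
begin

lemma contracted_ring_mult:
  assumes "cring C"
    and f: "f \<in> carrier (contracted_ring C G)" and h: "h \<in> carrier (contracted_ring C G)"
    and U: "finite U" "{a. f a \<noteq> \<zero>\<^bsub>C\<^esub>} \<subseteq> U" and V: "finite V" "{a. h a \<noteq> \<zero>\<^bsub>C\<^esub>} \<subseteq> V"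
    and g: "g \<noteq> sg_zero G"
  shows "(f \<otimes>\<^bsub>contracted_ring C G\<^esub> h) g =
     (\<Oplus>\<^bsub>C\<^esub>a\<in>U. \<Oplus>\<^bsub>C\<^esub>b\<in>V. if a \<cdot> b = g then f a \<otimes>\<^bsub>C\<^esub> h b else \<zero>\<^bsub>C\<^esub>)"
proof -
  interpret C: cring C by fact
  have car: "f a \<in> carrier C" "h a \<in> carrier C" for a
    using f h by (cases "a \<in> carrier G - {sg_zero G}"; auto simp: contracted_ring_def direct_sum_copies_def)+
  let ?P = "{(a, b). f a \<noteq> \<zero>\<^bsub>C\<^esub> \<and> h b \<noteq> \<zero>\<^bsub>C\<^esub> \<and> a \<cdot> b = g}"
  let ?F = "\<lambda>a b. if a \<cdot> b = g then f a \<otimes>\<^bsub>C\<^esub> h b else \<zero>\<^bsub>C\<^esub>"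
  have "(f \<otimes>\<^bsub>contracted_ring C G\<^esub> h) g = (\<Oplus>\<^bsub>C\<^esub>p\<in>?P. f (fst p) \<otimes>\<^bsub>C\<^esub> h (snd p))"
    using g by (simp add: contracted_ring_def)
  also have "\<dots> = (\<Oplus>\<^bsub>C\<^esub>p\<in>U \<times> V. ?F (fst p) (snd p))"
  proof (rule C.add.finprod_mono_neutral_cong_left)
    show "?F (fst i) (snd i) = \<zero>\<^bsub>C\<^esub>" if "i \<in> U \<times> V - ?P" for i
      using that car by auto
  qed (use U V in \<open>auto simp: car\<close>)
  also have "\<dots> = (\<Oplus>\<^bsub>C\<^esub>a\<in>U. \<Oplus>\<^bsub>C\<^esub>b\<in>V. ?F a b)"
    using U V by (intro C.finsum_Times) (auto simp: car)
  finally show ?thesis .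
qed

lemma assoc_algebra_contracted_ring:
  assumes "cring C"
  shows "assoc_algebra C (contracted_ring C G)"
proof -
  interpret C: cring C by fact
  let ?D = "direct_sum_copies C (carrier G - {sg_zero G})"
  let ?A = "contracted_ring C G"
  interpret D: assoc_algebra C ?D by (rule assoc_algebra_direct_sum_copies) fact
  have [simp]: "carrier ?A = carrier ?D" "ring.zero ?A = ring.zero ?D" "add ?A = add ?D" "smult ?A = smult ?D"
    by (simp_all add: contracted_ring_def)
  have "add_monoid ?A = add_monoid ?D" by simp
  then have ag: "abelian_group ?A"
    using D.module_axioms by (auto simp: module_def abelian_group_def abelian_monoid_def abelian_group_axioms_def)
  have "module C ?A"
    by (rule moduleI[OF assms ag]) (auto simp: D.smult_l_distr D.smult_r_distr D.smult_assoc1)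
  have car: "f a \<in> carrier C" if "f \<in> carrier ?D" for f a
    using that by (cases "a \<in> carrier G - {sg_zero G}"; auto simp: direct_sum_copies_def)
  have fin: "finite {s. f s \<noteq> \<zero>\<^bsub>C\<^esub>}" if "f \<in> carrier ?D" for f
    using that by (auto simp: direct_sum_copies_def)
  have out: "f s = \<zero>\<^bsub>C\<^esub>" if "f \<in> carrier ?D" "s \<notin> carrier G - {sg_zero G}" for f s
    using that by (auto simp: direct_sum_copies_def)
  have carI: "f \<in> carrier ?D"
    if "\<And>s. f s \<in> carrier C" "\<And>s. s \<notin> carrier G - {sg_zero G} \<Longrightarrow> f s = \<zero>\<^bsub>C\<^esub>"
       "{s. f s \<noteq> \<zero>\<^bsub>C\<^esub>} \<subseteq> T" "finite T" for f T
    using that by (auto simp: direct_sum_copies_def intro: finite_subset)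
  have add: "(x \<oplus>\<^bsub>?D\<^esub> y) s = x s \<oplus>\<^bsub>C\<^esub> y s" 
   and sm: "(c \<odot>\<^bsub>?D\<^esub> y) s = c \<otimes>\<^bsub>C\<^esub> y s" 
   and ze: "\<zero>\<^bsub>?D\<^esub> s = \<zero>\<^bsub>C\<^esub>" for x y c s
    by (simp_all add: direct_sum_copies_def)
  have mult0: "(f \<otimes>\<^bsub>?A\<^esub> h) (sg_zero G) = \<zero>\<^bsub>C\<^esub>" for f h
    by (simp add: contracted_ring_def)
  note multU = contracted_ring_mult[OF assms, simplified]
  define supp where "supp f = {s. f s \<noteq> \<zero>\<^bsub>C\<^esub>}" for f :: "'g \<Rightarrow> 'a"
  have supp: "finite (supp f)" "supp f \<subseteq> carrier G - {sg_zero G}" if "f \<in> carrier ?D" for f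
    using that fin out by (auto simp: supp_def)
  have suppU: "{s. f s \<noteq> \<zero>\<^bsub>C\<^esub>} \<subseteq> U" if "supp f \<subseteq> U" for f U
    using that by (simp add: supp_def)
  have multsupp: "(f \<otimes>\<^bsub>?A\<^esub> h) g = \<zero>\<^bsub>C\<^esub>"
    if "g \<notin> (\<lambda>(a,b). a \<cdot> b) ` (supp f \<times> supp h)" for f h g
  proof -
    have E: "{(a, b). f a \<noteq> \<zero>\<^bsub>C\<^esub> \<and> h b \<noteq> \<zero>\<^bsub>C\<^esub> \<and> a \<cdot> b = g} = {}"
      using that by (auto simp: supp_def)
    show ?thesis
      by (simp add: contracted_ring_def E)
  qed
  have mcar: "(f \<otimes>\<^bsub>?A\<^esub> h) g \<in> carrier C" if "f \<in> carrier ?D" "h \<in> carrier ?D" for f h g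
  proof (cases "g = sg_zero G")
    case False
    have "(f \<otimes>\<^bsub>?A\<^esub> h) g = (\<Oplus>\<^bsub>C\<^esub>a\<in>supp f. \<Oplus>\<^bsub>C\<^esub>b\<in>supp h. if a \<cdot> b = g then f a \<otimes>\<^bsub>C\<^esub> h b else \<zero>\<^bsub>C\<^esub>)"
      using that False supp by (intro multU) (auto simp: supp_def)
    also have "\<dots> \<in> carrier C"
      using that by (auto simp: car intro!: C.finsum_closed)
    finally show ?thesis .
  qed (simp add: mult0)
  have mclosed: "f \<otimes>\<^bsub>?A\<^esub> h \<in> carrier ?D" if "f \<in> carrier ?D" "h \<in> carrier ?D" for f h
  proof (rule carI)
    show "(f \<otimes>\<^bsub>?A\<^esub> h) s = \<zero>\<^bsub>C\<^esub>" if "s \<notin> carrier G - {sg_zero G}" for s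
    proof (cases "s = sg_zero G")
      case False
      then show ?thesis
        using that supp[OF \<open>f \<in> _\<close>] supp[OF \<open>h \<in> _\<close>] by (intro multsupp) (auto dest!: subsetD intro: sg_closed)
    qed (simp add: mult0)
    show "{s. (f \<otimes>\<^bsub>?A\<^esub> h) s \<noteq> \<zero>\<^bsub>C\<^esub>} \<subseteq> (\<lambda>(a,b). a \<cdot> b) ` (supp f \<times> supp h)"
      using multsupp by blast
  qed (use that supp mcar in auto)
  show ?thesis
  proof (intro assoc_algebra.intro assoc_algebra_axioms.intro, fact)
    fix x y z assume "x \<in> carrier ?A" "y \<in> carrier ?A" "z \<in> carrier ?A"
    then have xyz: "x \<in> carrier ?D" "y \<in> carrier ?D" "z \<in> carrier ?D" by simp_all
    define V where "V = supp x \<union> supp y \<union> supp z"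
    have V: "finite V" and V': "supp x \<subseteq> V" "supp y \<subseteq> V" "supp z \<subseteq> V"
      using supp xyz by (auto simp: V_def)
    have Vadd: "supp (f \<oplus>\<^bsub>?D\<^esub> h) \<subseteq> V" if "supp f \<subseteq> V" "supp h \<subseteq> V" for f h
    proof
      fix s assume "s \<in> supp (f \<oplus>\<^bsub>?D\<^esub> h)"
      then have "\<not> (f s = \<zero>\<^bsub>C\<^esub> \<and> h s = \<zero>\<^bsub>C\<^esub>)" by (auto simp: supp_def add)
      then show "s \<in> V" using that by (auto simp: supp_def)
    qed
    have Vsm: "supp (c \<odot>\<^bsub>?D\<^esub> f) \<subseteq> V" if "supp f \<subseteq> V" "c \<in> carrier C" for c f
    proof
      fix s assume "s \<in> supp (c \<odot>\<^bsub>?D\<^esub> f)"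
      then have "f s \<noteq> \<zero>\<^bsub>C\<^esub>" using that by (auto simp: supp_def sm)
      then show "s \<in> V" using that by (auto simp: supp_def)
    qed
    have mV: "(f \<otimes>\<^bsub>?A\<^esub> h) g =
       (\<Oplus>\<^bsub>C\<^esub>a\<in>V. \<Oplus>\<^bsub>C\<^esub>b\<in>V. if a \<cdot> b = g then f a \<otimes>\<^bsub>C\<^esub> h b else \<zero>\<^bsub>C\<^esub>)"
      if "g \<noteq> sg_zero G" "f \<in> carrier ?D" "h \<in> carrier ?D" "supp f \<subseteq> V" "supp h \<subseteq> V" for f h g
      using multU[OF that(2,3) V _ V _ that(1)] that(4,5) by (simp add: supp_def)
    show "x \<otimes>\<^bsub>?A\<^esub> y \<in> carrier ?A"
      using xyz by (simp add: mclosed)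
    show "(x \<oplus>\<^bsub>?A\<^esub> y) \<otimes>\<^bsub>?A\<^esub> z = x \<otimes>\<^bsub>?A\<^esub> z \<oplus>\<^bsub>?A\<^esub> y \<otimes>\<^bsub>?A\<^esub> z"
    proof
      fix g
      show "((x \<oplus>\<^bsub>?A\<^esub> y) \<otimes>\<^bsub>?A\<^esub> z) g = (x \<otimes>\<^bsub>?A\<^esub> z \<oplus>\<^bsub>?A\<^esub> y \<otimes>\<^bsub>?A\<^esub> z) g"
      proof (cases "g = sg_zero G")
        case False
        then show ?thesis
          using xyz V' by (simp add: add[of "_ \<otimes>\<^bsub>?A\<^esub> _"] mV Vadd)
            (rule trans[OF C.finsum2_cong C.finsum2_addf[symmetric]];
             auto simp: car add C.l_distr)
      qed (simp add: mult0 add)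
    qed
    show "z \<otimes>\<^bsub>?A\<^esub> (x \<oplus>\<^bsub>?A\<^esub> y) = z \<otimes>\<^bsub>?A\<^esub> x \<oplus>\<^bsub>?A\<^esub> z \<otimes>\<^bsub>?A\<^esub> y"
    proof
      fix g
      show "(z \<otimes>\<^bsub>?A\<^esub> (x \<oplus>\<^bsub>?A\<^esub> y)) g = (z \<otimes>\<^bsub>?A\<^esub> x \<oplus>\<^bsub>?A\<^esub> z \<otimes>\<^bsub>?A\<^esub> y) g"
      proof (cases "g = sg_zero G")
        case False
        then show ?thesis
          using xyz V' by (simp add: add[of "_ \<otimes>\<^bsub>?A\<^esub> _"] mV Vadd)
            (rule trans[OF C.finsum2_cong C.finsum2_addf[symmetric]];
             auto simp: car add C.r_distr)
      qed (simp add: mult0 add)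
    qed
    have dist: "c \<otimes>\<^bsub>C\<^esub> (\<Oplus>\<^bsub>C\<^esub>a\<in>I. \<Oplus>\<^bsub>C\<^esub>b\<in>J. F a b) = (\<Oplus>\<^bsub>C\<^esub>a\<in>I. \<Oplus>\<^bsub>C\<^esub>b\<in>J. c \<otimes>\<^bsub>C\<^esub> F a b)"
      if "finite I" "finite J" "c \<in> carrier C" "\<And>a b. F a b \<in> carrier C" for c I J and F :: "'g \<Rightarrow> 'g \<Rightarrow> 'a"
      using that by (simp add: C.finsum_rdistr Pi_def)
    {
      fix c assume c: "c \<in> carrier C"
      show "(c \<odot>\<^bsub>?A\<^esub> x) \<otimes>\<^bsub>?A\<^esub> y = c \<odot>\<^bsub>?A\<^esub> (x \<otimes>\<^bsub>?A\<^esub> y)"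
      proof
        fix g
        show "((c \<odot>\<^bsub>?A\<^esub> x) \<otimes>\<^bsub>?A\<^esub> y) g = (c \<odot>\<^bsub>?A\<^esub> (x \<otimes>\<^bsub>?A\<^esub> y)) g"
        proof (cases "g = sg_zero G")
          case False
          then show ?thesis
            using xyz V V' c by (simp add: sm[of _ "_ \<otimes>\<^bsub>?A\<^esub> _"] mV Vsm)
              (rule trans[OF C.finsum2_cong dist[symmetric]]; auto simp: car sm C.m_assoc)
        qed (simp add: mult0 sm c)
      qed
      show "x \<otimes>\<^bsub>?A\<^esub> (c \<odot>\<^bsub>?A\<^esub> y) = c \<odot>\<^bsub>?A\<^esub> (x \<otimes>\<^bsub>?A\<^esub> y)"
      proof
        fix g
        show "(x \<otimes>\<^bsub>?A\<^esub> (c \<odot>\<^bsub>?A\<^esub> y)) g = (c \<odot>\<^bsub>?A\<^esub> (x \<otimes>\<^bsub>?A\<^esub> y)) g"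
        proof (cases "g = sg_zero G")
          case False
          then show ?thesis
            using xyz V V' c by (simp add: sm[of _ "_ \<otimes>\<^bsub>?A\<^esub> _"] mV Vsm)
              (rule trans[OF C.finsum2_cong dist[symmetric]]; auto simp: car sm C.m_lcomm)
        qed (simp add: mult0 sm c)
      qed
    }
    show "(x \<otimes>\<^bsub>?A\<^esub> y) \<otimes>\<^bsub>?A\<^esub> z = x \<otimes>\<^bsub>?A\<^esub> (y \<otimes>\<^bsub>?A\<^esub> z)"
    proof
      fix g
      show "((x \<otimes>\<^bsub>?A\<^esub> y) \<otimes>\<^bsub>?A\<^esub> z) g = (x \<otimes>\<^bsub>?A\<^esub> (y \<otimes>\<^bsub>?A\<^esub> z)) g"
      proof (cases "g = sg_zero G")
        case g: False
        have VG: "V \<subseteq> carrier G" using supp xyz by (auto simp: V_def)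
        define U where "U = (\<lambda>(a,b). a \<cdot> b) ` (V \<times> V)"
        have U: "finite U" "U \<subseteq> carrier G" using V VG by (auto simp: U_def intro: sg_closed)
        have sU: "{s. (f \<otimes>\<^bsub>?A\<^esub> h) s \<noteq> \<zero>\<^bsub>C\<^esub>} \<subseteq> U" if "supp f \<subseteq> V" "supp h \<subseteq> V" for f h
        proof
          fix s assume s: "s \<in> {s. (f \<otimes>\<^bsub>?A\<^esub> h) s \<noteq> \<zero>\<^bsub>C\<^esub>}"
          show "s \<in> U"
          proof (rule ccontr)
            assume "s \<notin> U"
            then have "(f \<otimes>\<^bsub>?A\<^esub> h) s = \<zero>\<^bsub>C\<^esub>"
              using that by (intro multsupp) (auto simp: U_def)
            with s show False by simp
          qed
        qed
        have VV: "finite (V \<times> V)" using V by simp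
        let ?t = "\<lambda>c d b. x c \<otimes>\<^bsub>C\<^esub> y d \<otimes>\<^bsub>C\<^esub> z b"
        let ?T = "\<lambda>c d b. if c \<cdot> d \<cdot> b = g then ?t c d b else \<zero>\<^bsub>C\<^esub>"
        note car' = xyz[THEN car]
        have if_mult_r: "(if P then u else \<zero>\<^bsub>C\<^esub>) \<otimes>\<^bsub>C\<^esub> v = (if P then u \<otimes>\<^bsub>C\<^esub> v else \<zero>\<^bsub>C\<^esub>)"
          and if_mult_l: "v \<otimes>\<^bsub>C\<^esub> (if P then u else \<zero>\<^bsub>C\<^esub>) = (if P then v \<otimes>\<^bsub>C\<^esub> u else \<zero>\<^bsub>C\<^esub>)"
          if "v \<in> carrier C" for P u v using that by auto
        have pair: "(f \<otimes>\<^bsub>?A\<^esub> h) a = (\<Oplus>\<^bsub>C\<^esub>p\<in>V\<times>V. if fst p \<cdot> snd p = a then f (fst p) \<otimes>\<^bsub>C\<^esub> h (snd p) else \<zero>\<^bsub>C\<^esub>)"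
          if "a \<noteq> sg_zero G" "f \<in> carrier ?D" "h \<in> carrier ?D" "supp f \<subseteq> V" "supp h \<subseteq> V" for f h a
          unfolding mV[OF that]
          by (rule C.finsum_Times[symmetric]) (use V that in \<open>auto simp: car\<close>)
        have "((x \<otimes>\<^bsub>?A\<^esub> y) \<otimes>\<^bsub>?A\<^esub> z) g =
            (\<Oplus>\<^bsub>C\<^esub>a\<in>U. \<Oplus>\<^bsub>C\<^esub>b\<in>V. if a \<cdot> b = g then (x \<otimes>\<^bsub>?A\<^esub> y) a \<otimes>\<^bsub>C\<^esub> z b else \<zero>\<^bsub>C\<^esub>)"
          using xyz V U V' g by (intro multU sU) (auto simp: mclosed supp_def)
        also have "\<dots> = (\<Oplus>\<^bsub>C\<^esub>a\<in>U. \<Oplus>\<^bsub>C\<^esub>b\<in>V. \<Oplus>\<^bsub>C\<^esub>p\<in>V\<times>V.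
            if fst p \<cdot> snd p = a then if a \<cdot> b = g then ?t (fst p) (snd p) b else \<zero>\<^bsub>C\<^esub> else \<zero>\<^bsub>C\<^esub>)"
        proof (rule C.finsum2_cong)
          fix a b assume ab: "a \<in> U" "b \<in> V"
          show "(if a \<cdot> b = g then (x \<otimes>\<^bsub>?A\<^esub> y) a \<otimes>\<^bsub>C\<^esub> z b else \<zero>\<^bsub>C\<^esub>) = (\<Oplus>\<^bsub>C\<^esub>p\<in>V\<times>V.
            if fst p \<cdot> snd p = a then if a \<cdot> b = g then ?t (fst p) (snd p) b else \<zero>\<^bsub>C\<^esub> else \<zero>\<^bsub>C\<^esub>)"
          proof (cases "a \<cdot> b = g")
            case True
            then have "a \<noteq> sg_zero G" using g ab VG by (auto simp: sg_zero_left subset_iff)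
            then show ?thesis
              using True xyz V' VV by (simp add: pair C.finsum_ldistr car if_mult_r Pi_def cong: if_cong)
          qed (simp cong: if_cong)
        qed (auto simp: car' intro!: C.finsum_closed)
        also have "\<dots> = (\<Oplus>\<^bsub>C\<^esub>b\<in>V. \<Oplus>\<^bsub>C\<^esub>a\<in>U. \<Oplus>\<^bsub>C\<^esub>p\<in>V\<times>V.
            if fst p \<cdot> snd p = a then if a \<cdot> b = g then ?t (fst p) (snd p) b else \<zero>\<^bsub>C\<^esub> else \<zero>\<^bsub>C\<^esub>)"
          by (rule C.finsum_swap[OF U(1) V]) (auto simp: car' intro!: C.finsum_closed)
        also have "\<dots> = (\<Oplus>\<^bsub>C\<^esub>b\<in>V. \<Oplus>\<^bsub>C\<^esub>p\<in>V\<times>V. \<Oplus>\<^bsub>C\<^esub>a\<in>U.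
            if fst p \<cdot> snd p = a then if a \<cdot> b = g then ?t (fst p) (snd p) b else \<zero>\<^bsub>C\<^esub> else \<zero>\<^bsub>C\<^esub>)"
          by (intro C.finsum_cong' C.finsum_swap[OF U(1) VV]) (auto simp: car' intro!: C.finsum_closed)
        also have "\<dots> = (\<Oplus>\<^bsub>C\<^esub>b\<in>V. \<Oplus>\<^bsub>C\<^esub>p\<in>V\<times>V. ?T (fst p) (snd p) b)"
          by (intro C.finsum2_cong C.add.finprod_singleton) (use U in \<open>auto simp: U_def car'\<close>)
        also have "\<dots> = (\<Oplus>\<^bsub>C\<^esub>b\<in>V. \<Oplus>\<^bsub>C\<^esub>c\<in>V. \<Oplus>\<^bsub>C\<^esub>d\<in>V. ?T c d b)"
          by (intro C.finsum_cong' C.finsum_Times) (auto simp: car' V intro!: C.finsum_closed)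
        also have "\<dots> = (\<Oplus>\<^bsub>C\<^esub>c\<in>V. \<Oplus>\<^bsub>C\<^esub>b\<in>V. \<Oplus>\<^bsub>C\<^esub>d\<in>V. ?T c d b)"
          by (rule C.finsum_swap[OF V V]) (auto simp: car' intro!: C.finsum_closed)
        also have "\<dots> = (\<Oplus>\<^bsub>C\<^esub>c\<in>V. \<Oplus>\<^bsub>C\<^esub>d\<in>V. \<Oplus>\<^bsub>C\<^esub>b\<in>V. ?T c d b)"
          by (intro C.finsum_cong' C.finsum_swap[OF V V]) (auto simp: car' intro!: C.finsum_closed)
        finally have lhs: "((x \<otimes>\<^bsub>?A\<^esub> y) \<otimes>\<^bsub>?A\<^esub> z) g = (\<Oplus>\<^bsub>C\<^esub>c\<in>V. \<Oplus>\<^bsub>C\<^esub>d\<in>V. \<Oplus>\<^bsub>C\<^esub>b\<in>V. ?T c d b)" .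
        have "(x \<otimes>\<^bsub>?A\<^esub> (y \<otimes>\<^bsub>?A\<^esub> z)) g =
            (\<Oplus>\<^bsub>C\<^esub>c\<in>V. \<Oplus>\<^bsub>C\<^esub>a\<in>U. if c \<cdot> a = g then x c \<otimes>\<^bsub>C\<^esub> (y \<otimes>\<^bsub>?A\<^esub> z) a else \<zero>\<^bsub>C\<^esub>)"
          using xyz V U V' g by (intro multU sU) (auto simp: mclosed supp_def)
        also have "\<dots> = (\<Oplus>\<^bsub>C\<^esub>c\<in>V. \<Oplus>\<^bsub>C\<^esub>a\<in>U. \<Oplus>\<^bsub>C\<^esub>p\<in>V\<times>V.
            if fst p \<cdot> snd p = a then if c \<cdot> a = g then ?t c (fst p) (snd p) else \<zero>\<^bsub>C\<^esub> else \<zero>\<^bsub>C\<^esub>)"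
        proof (rule C.finsum2_cong)
          fix c a assume ab: "c \<in> V" "a \<in> U"
          show "(if c \<cdot> a = g then x c \<otimes>\<^bsub>C\<^esub> (y \<otimes>\<^bsub>?A\<^esub> z) a else \<zero>\<^bsub>C\<^esub>) = (\<Oplus>\<^bsub>C\<^esub>p\<in>V\<times>V.
            if fst p \<cdot> snd p = a then if c \<cdot> a = g then ?t c (fst p) (snd p) else \<zero>\<^bsub>C\<^esub> else \<zero>\<^bsub>C\<^esub>)"
          proof (cases "c \<cdot> a = g")
            case True
            then have "a \<noteq> sg_zero G" using g ab VG by (auto simp: sg_zero_right subset_iff)
            then show ?thesis
              using True xyz V' VV by (simp add: pair C.finsum_rdistr car if_mult_l Pi_def C.m_assoc cong: if_cong)
          qed (simp cong: if_cong)
        qed (auto simp: car' intro!: C.finsum_closed)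
        also have "\<dots> = (\<Oplus>\<^bsub>C\<^esub>c\<in>V. \<Oplus>\<^bsub>C\<^esub>p\<in>V\<times>V. \<Oplus>\<^bsub>C\<^esub>a\<in>U.
            if fst p \<cdot> snd p = a then if c \<cdot> a = g then ?t c (fst p) (snd p) else \<zero>\<^bsub>C\<^esub> else \<zero>\<^bsub>C\<^esub>)"
          by (intro C.finsum_cong' C.finsum_swap[OF U(1) VV]) (auto simp: car' intro!: C.finsum_closed)
        also have "\<dots> = (\<Oplus>\<^bsub>C\<^esub>c\<in>V. \<Oplus>\<^bsub>C\<^esub>p\<in>V\<times>V.
            if c \<cdot> (fst p \<cdot> snd p) = g then ?t c (fst p) (snd p) else \<zero>\<^bsub>C\<^esub>)"
          by (intro C.finsum2_cong C.add.finprod_singleton) (use U in \<open>auto simp: U_def car'\<close>)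
        also have "\<dots> = (\<Oplus>\<^bsub>C\<^esub>c\<in>V. \<Oplus>\<^bsub>C\<^esub>p\<in>V\<times>V. ?T c (fst p) (snd p))"
          by (intro C.finsum2_cong) (use VG in \<open>auto simp: car' sg_assoc subset_iff\<close>)
        also have "\<dots> = (\<Oplus>\<^bsub>C\<^esub>c\<in>V. \<Oplus>\<^bsub>C\<^esub>d\<in>V. \<Oplus>\<^bsub>C\<^esub>b\<in>V. ?T c d b)"
          by (intro C.finsum_cong' C.finsum_Times) (auto simp: car' V intro!: C.finsum_closed)
        finally show ?thesis
          using lhs by simp
      qed (simp add: mult0)
    qed
  qed
qed

end

end

theory Submission
  imports Defs
begin

text \<open>Modulo commutators an element of the contracted semigroup ring may be moved along \<open>\<sim>\<close>, and
  hence becomes a combination of chosen representatives of the nonzero classes. Summing the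
  coefficients over a fixed class is a linear trace with values in \<open>C\<close>, so these representatives
  are independent modulo commutators. This gives (2), and (1) and (3) follow from (2).\<close>

text \<open>The commutator subgroup is generated by addition only, whereas moving a basis element
  along \<open>sim\<close> has to work for any scalar multiple of it. This is possible because a
  scalar can be absorbed into one factor: c(ab) - c(ba) = (ca)b - b(ca) is a single commutator. The
  class [0] needs its own treatment. The zero of G is the zero of the ring, so every element of [0]
  is a sum of commutators and must not appear in a normal form. Hence the zero is the representative
  of [0], and the class functions that yield traces are required to vanish at the zero. Since C is
  an arbitrary commutative ring, no dimension count is available. Independence is tested by
  functionals instead, one per nonzero class, each isolating a single coefficient.\<close>

lemma finsum_hom:
  assumes "abelian_group A" and "abelian_group B" and t: "t \<in> carrier A \<rightarrow> carrier B"
    and add: "\<And>u v. \<lbrakk>u \<in> carrier A; v \<in> carrier A\<rbrakk> \<Longrightarrow> t (u \<oplus>\<^bsub>A\<^esub> v) = t u \<oplus>\<^bsub>B\<^esub> t v"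
    and "finite I" and "x \<in> I \<rightarrow> carrier A"
  shows "t (\<Oplus>\<^bsub>A\<^esub>i\<in>I. x i) = (\<Oplus>\<^bsub>B\<^esub>i\<in>I. t (x i))"
proof -
  interpret A: abelian_group A by fact
  interpret B: abelian_group B by fact
  \<comment> \<open>Preservation of zero is not part of being additive; it follows by cancellation
    in the target group.\<close>
  have "t \<zero>\<^bsub>A\<^esub> \<oplus>\<^bsub>B\<^esub> t \<zero>\<^bsub>A\<^esub> = t \<zero>\<^bsub>A\<^esub>"
    using add[of "\<zero>\<^bsub>A\<^esub>" "\<zero>\<^bsub>A\<^esub>"] by simp
  moreover have "t \<zero>\<^bsub>A\<^esub> \<in> carrier B"
    using t by auto
  ultimately have zero: "t \<zero>\<^bsub>A\<^esub> = \<zero>\<^bsub>B\<^esub>"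
    by (metis B.add.r_cancel_one')
  show ?thesis
    using \<open>finite I\<close> \<open>x \<in> I \<rightarrow> carrier A\<close>
  proof (induction I)
    case empty
    then show ?case by (simp add: zero)
  next
    case (insert i I)
    then have "t (\<Oplus>\<^bsub>A\<^esub>i\<in>insert i I. x i) = t (x i) \<oplus>\<^bsub>B\<^esub> t (\<Oplus>\<^bsub>A\<^esub>i\<in>I. x i)"
      by (simp add: add Pi_def)
    also have "\<dots> = (\<Oplus>\<^bsub>B\<^esub>i\<in>insert i I. t (x i))"
      using insert t by (simp add: Pi_def)
    finally show ?case .
  qed
qed

section \<open>The base ring as an algebra over itself\<close>

text \<open>Serves as the target of the coefficient functionals, which thereby are traces in the
  formal sense, and also as the unital algebra that witnesses existence in (3).\<close>

definition self_algebra :: "'c ring \<Rightarrow> ('c, 'c) module" where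
  "self_algebra C = \<lparr>carrier = carrier C, monoid.mult = monoid.mult C, one = one C,
     ring.zero = ring.zero C, add = add C, smult = monoid.mult C\<rparr>"

lemma self_algebra_simps [simp]:
  "carrier (self_algebra C) = carrier C"
  "x \<otimes>\<^bsub>self_algebra C\<^esub> y = x \<otimes>\<^bsub>C\<^esub> y" "x \<oplus>\<^bsub>self_algebra C\<^esub> y = x \<oplus>\<^bsub>C\<^esub> y"
  "\<one>\<^bsub>self_algebra C\<^esub> = \<one>\<^bsub>C\<^esub>" "\<zero>\<^bsub>self_algebra C\<^esub> = \<zero>\<^bsub>C\<^esub>" "c \<odot>\<^bsub>self_algebra C\<^esub> x = c \<otimes>\<^bsub>C\<^esub> x"
  by (simp_all add: self_algebra_def)

lemma unital_algebra_self_algebra: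
  assumes "cring C"
  shows "unital_algebra C (self_algebra C)"
proof -
  interpret cring C by fact
  have grp: "abelian_group (self_algebra C)"
    by (rule abelian_groupI) (auto simp: a_ac intro!: bexI[where x = "\<ominus>\<^bsub>C\<^esub> _"] l_neg)
  moreover have "module C (self_algebra C)"
    by (rule moduleI[OF assms grp]) (auto simp: l_distr r_distr m_assoc)
  moreover have "ring (self_algebra C)"
    by (intro ringI grp monoidI) (auto simp: l_distr r_distr m_assoc)
  ultimately show ?thesis
    unfolding unital_algebra_def
    by (auto intro!: assoc_algebra.intro assoc_algebra_axioms.intro simp: l_distr r_distr m_ac)
qed

lemma direct_sum_copies_simps:
  "(x \<oplus>\<^bsub>direct_sum_copies C S\<^esub> y) s = x s \<oplus>\<^bsub>C\<^esub> y s"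
  "(c \<odot>\<^bsub>direct_sum_copies C S\<^esub> x) s = c \<otimes>\<^bsub>C\<^esub> x s"
  "\<zero>\<^bsub>direct_sum_copies C S\<^esub> = (\<lambda>s. \<zero>\<^bsub>C\<^esub>)"
  by (simp_all add: direct_sum_copies_def)

section \<open>Equivalence classes of the semigroup and their representatives\<close>

context semigroup_with_zero
begin

lemma sim_class_eq_iff:
  assumes "g \<in> carrier G" "h \<in> carrier G"
  shows "sim_class G g = sim_class G h \<longleftrightarrow> (g, h) \<in> sim G"
  unfolding sim_class_def using equiv_sim assms by (rule eq_equiv_class_iff)

lemma mem_sim_class_iff: "h \<in> sim_class G g \<longleftrightarrow> (g, h) \<in> sim G"
  by (simp add: sim_class_def)

lemma sim_carrier: "(g, h) \<in> sim G \<Longrightarrow> g \<in> carrier G \<and> h \<in> carrier G"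
  by (simp add: sim_def)

lemma sim_class_self: "g \<in> carrier G \<Longrightarrow> g \<in> sim_class G g"
  by (simp add: mem_sim_class_iff sim_def)

lemma sim_class_mult_commute:
  assumes "a \<in> carrier G" "b \<in> carrier G"
  shows "sim_class G (a \<cdot> b) = sim_class G (b \<cdot> a)"
  using assms by (auto simp: sim_class_eq_iff sg_closed sim_def swap_step_def)

lemma nonzero_classes_eq:
  "nonzero_classes G = sim_class G ` carrier G - {sim_class G (sg_zero G)}"
  by (auto simp: nonzero_classes_def quotient_def sim_class_def)

text \<open>The choice is made per class, so \<open>r\<close> is constant on classes. Sending all of
  [0] to the zero ensures that a representative other than the zero lies in a nonzero class.\<close>

lemma class_representatives:
  obtains r where "r \<in> carrier G \<rightarrow> carrier G"
    and "\<And>g. g \<in> carrier G \<Longrightarrow> sim_class G (r g) = sim_class G g"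
    and "\<And>g h. sim_class G g = sim_class G h \<Longrightarrow> r g = r h"
    and "r (sg_zero G) = sg_zero G"
proof
  define r where "r g = (if sim_class G g = sim_class G (sg_zero G) then sg_zero G
    else SOME h. h \<in> sim_class G g)" for g
  have some: "(SOME h. h \<in> sim_class G g) \<in> sim_class G g" if "g \<in> carrier G" for g
    using sim_class_self[OF that] by (rule someI)
  then have sim: "(g, r g) \<in> sim G" if "g \<in> carrier G" for g
    using that by (auto simp: r_def mem_sim_class_iff sim_class_eq_iff sg_zero_closed)
  show "r \<in> carrier G \<rightarrow> carrier G"
    using sim sim_carrier by blast
  show "sim_class G (r g) = sim_class G g" if "g \<in> carrier G" for g
    using sim[OF that] sim_carrier[OF sim[OF that]] by (metis sim_class_eq_iff)
  show "r g = r h" if "sim_class G g = sim_class G h" for g h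
    unfolding r_def that ..
  show "r (sg_zero G) = sg_zero G"
    by (simp add: r_def)
qed

end

section \<open>Basis expansion in the contracted semigroup ring\<close>

locale contracted_semigroup_ring = C: cring C + semigroup_with_zero G
  for C :: "'c ring" and G :: "'g zero_semigroup" (structure)
begin

abbreviation A where "A \<equiv> contracted_ring C G"
abbreviation e where "e \<equiv> sg_elem C G"

sublocale A: assoc_algebra C A
  by (rule assoc_algebra_contracted_ring) (rule C.is_cring)

lemma contracted_ring_simps:
  "(x \<oplus>\<^bsub>A\<^esub> y) g = x g \<oplus>\<^bsub>C\<^esub> y g" "(c \<odot>\<^bsub>A\<^esub> x) g = c \<otimes>\<^bsub>C\<^esub> x g" "\<zero>\<^bsub>A\<^esub> = (\<lambda>g. \<zero>\<^bsub>C\<^esub>)"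
  by (simp_all add: contracted_ring_def direct_sum_copies_def)

lemma contracted_ring_carrier:
  "x \<in> carrier A \<longleftrightarrow> range x \<subseteq> carrier C \<and> {g. x g \<noteq> \<zero>\<^bsub>C\<^esub>} \<subseteq> carrier G - {sg_zero G} \<and>
    finite {g. x g \<noteq> \<zero>\<^bsub>C\<^esub>}"
  unfolding contracted_ring_def direct_sum_copies_def by (auto simp: subset_iff)

lemma coeff_closed [simp]: "x \<in> carrier A \<Longrightarrow> x g \<in> carrier C"
  by (auto simp: contracted_ring_carrier)

lemma finite_support: "x \<in> carrier A \<Longrightarrow> finite {g. x g \<noteq> \<zero>\<^bsub>C\<^esub>}"
  by (simp add: contracted_ring_carrier)

lemma sg_elem_closed [simp]: "g \<in> carrier G \<Longrightarrow> e g \<in> carrier A"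
  by (auto simp: contracted_ring_carrier sg_elem_def)

text \<open>Holds even when a factor or the product is the zero of G, because \<open>e\<close> sends
  that zero to the zero function. Otherwise the supports are singletons and the convolution sum has
  one term.\<close>

lemma sg_elem_mult:
  assumes "a \<in> carrier G" "b \<in> carrier G"
  shows "e a \<otimes>\<^bsub>A\<^esub> e b = e (a \<cdot> b)"
proof
  fix g
  show "(e a \<otimes>\<^bsub>A\<^esub> e b) g = e (a \<cdot> b) g"
  proof (cases "g = sg_zero G")
    case True
    then show ?thesis by (auto simp: contracted_ring_def sg_elem_def)
  next
    case False
    have "(e a \<otimes>\<^bsub>A\<^esub> e b) g =
        (\<Oplus>\<^bsub>C\<^esub>u\<in>{a}. \<Oplus>\<^bsub>C\<^esub>v\<in>{b}. if u \<cdot> v = g then e a u \<otimes>\<^bsub>C\<^esub> e b v else \<zero>\<^bsub>C\<^esub>)"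
      using assms False by (intro contracted_ring_mult[OF C.is_cring] sg_elem_closed) (auto simp: sg_elem_def)
    also have "\<dots> = e (a \<cdot> b) g"
      using assms False by (auto simp: sg_elem_def sg_zero_left sg_zero_right)
    finally show ?thesis .
  qed
qed

lemma finsum_coeff:
  assumes "finite I" "x \<in> I \<rightarrow> carrier A"
  shows "(\<Oplus>\<^bsub>A\<^esub>i\<in>I. x i) g = (\<Oplus>\<^bsub>C\<^esub>i\<in>I. x i g)"
  by (rule finsum_hom[OF A.M.abelian_group_axioms C.is_abelian_group _ _ assms, where t = "\<lambda>x. x g"])
    (auto simp: contracted_ring_simps)

lemma decomposition:
  assumes "x \<in> carrier A" "finite U" "U \<subseteq> carrier G" "{g. x g \<noteq> \<zero>\<^bsub>C\<^esub>} \<subseteq> U"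
  shows "x = (\<Oplus>\<^bsub>A\<^esub>g\<in>U. x g \<odot>\<^bsub>A\<^esub> e g)"
proof
  fix h
  \<comment> \<open>The index set U may contain the zero of G, where \<open>e\<close> vanishes; the
    term there is harmless because the coefficient of x vanishes as well.\<close>
  have x0: "x (sg_zero G) = \<zero>\<^bsub>C\<^esub>"
    using assms(1) by (auto simp: contracted_ring_carrier)
  have "(\<Oplus>\<^bsub>A\<^esub>g\<in>U. x g \<odot>\<^bsub>A\<^esub> e g) h = (\<Oplus>\<^bsub>C\<^esub>g\<in>U. x g \<otimes>\<^bsub>C\<^esub> e g h)"
    using assms by (subst finsum_coeff) (auto simp: contracted_ring_simps)
  also have "\<dots> = (\<Oplus>\<^bsub>C\<^esub>g\<in>U. if h = g then x g else \<zero>\<^bsub>C\<^esub>)"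
    using assms(1) x0 by (intro C.finsum_cong') (auto simp: sg_elem_def)
  also have "\<dots> = x h"
  proof (cases "h \<in> U")
    case True
    then show ?thesis
      using assms by (intro C.finsum_singleton) auto
  next
    case False
    then have "(\<Oplus>\<^bsub>C\<^esub>g\<in>U. if h = g then x g else \<zero>\<^bsub>C\<^esub>) = \<zero>\<^bsub>C\<^esub>"
      by (intro C.add.finprod_one_eqI) auto
    then show ?thesis
      using False assms(4) by force
  qed
  finally show "x h = (\<Oplus>\<^bsub>A\<^esub>g\<in>U. x g \<odot>\<^bsub>A\<^esub> e g) h" ..
qed

text \<open>Elements are built up one scalar multiple of a basis element at a time; this reduces
  linear and bilinear claims to basis elements.\<close>

lemma contracted_ring_induct [consumes 1, case_names zero add]:
  assumes "x \<in> carrier A" and zero: "P \<zero>\<^bsub>A\<^esub>"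
    and add: "\<And>c g x. \<lbrakk>c \<in> carrier C; g \<in> carrier G; x \<in> carrier A; P x\<rbrakk> \<Longrightarrow> P (c \<odot>\<^bsub>A\<^esub> e g \<oplus>\<^bsub>A\<^esub> x)"
  shows "P x"
proof -
  have *: "P (\<Oplus>\<^bsub>A\<^esub>g\<in>U. x g \<odot>\<^bsub>A\<^esub> e g)" if "finite U" "U \<subseteq> carrier G" for U
    using that
  proof (induction U)
    case empty
    then show ?case using zero by (simp)
  next
    case (insert g U)
    then show ?case
      using assms(1) by (subst A.finsum_insert) (auto simp: subset_iff intro!: add A.finsum_closed)
  qed
  have "P (\<Oplus>\<^bsub>A\<^esub>g\<in>{g. x g \<noteq> \<zero>\<^bsub>C\<^esub>}. x g \<odot>\<^bsub>A\<^esub> e g)"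
    using assms(1) by (intro *) (auto simp: contracted_ring_carrier)
  moreover have "x = (\<Oplus>\<^bsub>A\<^esub>g\<in>{g. x g \<noteq> \<zero>\<^bsub>C\<^esub>}. x g \<odot>\<^bsub>A\<^esub> e g)"
    using assms(1) by (intro decomposition) (auto simp: contracted_ring_carrier)
  ultimately show ?thesis
    by simp
qed

section \<open>Traces obtained from class functions\<close>

text \<open>The C-linear extension of f from the basis. The sum is taken over the support of x, so
  that it is finite.\<close>

definition coeff_form :: "('g \<Rightarrow> 'c) \<Rightarrow> ('g \<Rightarrow> 'c) \<Rightarrow> 'c" where
  "coeff_form f x = (\<Oplus>\<^bsub>C\<^esub>g\<in>{g. x g \<noteq> \<zero>\<^bsub>C\<^esub>}. x g \<otimes>\<^bsub>C\<^esub> f g)"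

text \<open>Cancellation can shrink supports under addition and scaling, so linearity is verified by
  comparing all sums over one common finite set.\<close>

lemma coeff_form_superset:
  assumes "x \<in> carrier A" "f \<in> UNIV \<rightarrow> carrier C" "finite U" "{g. x g \<noteq> \<zero>\<^bsub>C\<^esub>} \<subseteq> U"
  shows "coeff_form f x = (\<Oplus>\<^bsub>C\<^esub>g\<in>U. x g \<otimes>\<^bsub>C\<^esub> f g)"
  unfolding coeff_form_def
  by (rule C.add.finprod_mono_neutral_cong_left) (use assms in \<open>auto simp: Pi_def\<close>)

lemma coeff_form_closed [simp]:
  assumes "x \<in> carrier A" "f \<in> UNIV \<rightarrow> carrier C"
  shows "coeff_form f x \<in> carrier C"
  unfolding coeff_form_def using assms by (auto intro!: C.finsum_closed simp: Pi_def)

lemma coeff_form_add: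
  assumes "x \<in> carrier A" "y \<in> carrier A" "f \<in> UNIV \<rightarrow> carrier C"
  shows "coeff_form f (x \<oplus>\<^bsub>A\<^esub> y) = coeff_form f x \<oplus>\<^bsub>C\<^esub> coeff_form f y"
proof -
  define U where "U = {g. x g \<noteq> \<zero>\<^bsub>C\<^esub>} \<union> {g. y g \<noteq> \<zero>\<^bsub>C\<^esub>}"
  have "finite U"
    using assms by (simp add: U_def finite_support)
  then have "coeff_form f (x \<oplus>\<^bsub>A\<^esub> y) = (\<Oplus>\<^bsub>C\<^esub>g\<in>U. (x g \<oplus>\<^bsub>C\<^esub> y g) \<otimes>\<^bsub>C\<^esub> f g)"
    using assms by (subst coeff_form_superset[of _ _ U]) (auto simp: U_def contracted_ring_simps)
  also have "\<dots> = (\<Oplus>\<^bsub>C\<^esub>g\<in>U. x g \<otimes>\<^bsub>C\<^esub> f g \<oplus>\<^bsub>C\<^esub> y g \<otimes>\<^bsub>C\<^esub> f g)"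
    using assms by (intro C.finsum_cong') (auto simp: Pi_def C.l_distr)
  also have "\<dots> = (\<Oplus>\<^bsub>C\<^esub>g\<in>U. x g \<otimes>\<^bsub>C\<^esub> f g) \<oplus>\<^bsub>C\<^esub> (\<Oplus>\<^bsub>C\<^esub>g\<in>U. y g \<otimes>\<^bsub>C\<^esub> f g)"
    using assms by (intro C.finsum_addf) (auto simp: Pi_def)
  also have "\<dots> = coeff_form f x \<oplus>\<^bsub>C\<^esub> coeff_form f y"
    using assms \<open>finite U\<close> by (simp add: coeff_form_superset[of _ _ U] U_def)
  finally show ?thesis .
qed

lemma coeff_form_smult:
  assumes "c \<in> carrier C" "x \<in> carrier A" "f \<in> UNIV \<rightarrow> carrier C"
  shows "coeff_form f (c \<odot>\<^bsub>A\<^esub> x) = c \<otimes>\<^bsub>C\<^esub> coeff_form f x"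
proof -
  define U where "U = {g. x g \<noteq> \<zero>\<^bsub>C\<^esub>}"
  have "finite U"
    using assms by (simp add: U_def finite_support)
  then have "coeff_form f (c \<odot>\<^bsub>A\<^esub> x) = (\<Oplus>\<^bsub>C\<^esub>g\<in>U. (c \<otimes>\<^bsub>C\<^esub> x g) \<otimes>\<^bsub>C\<^esub> f g)"
    using assms by (subst coeff_form_superset[of _ _ U]) (auto simp: U_def contracted_ring_simps)
  also have "\<dots> = (\<Oplus>\<^bsub>C\<^esub>g\<in>U. c \<otimes>\<^bsub>C\<^esub> (x g \<otimes>\<^bsub>C\<^esub> f g))"
    using assms by (intro C.finsum_cong') (auto simp: Pi_def C.m_assoc)
  also have "\<dots> = c \<otimes>\<^bsub>C\<^esub> coeff_form f x"
    using assms \<open>finite U\<close>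
    by (subst C.finsum_rdistr[symmetric]) (auto simp: coeff_form_superset[of _ _ U] U_def Pi_def)
  finally show ?thesis .
qed

lemma coeff_form_sg_elem:
  assumes "g \<in> carrier G" "f \<in> UNIV \<rightarrow> carrier C" "f (sg_zero G) = \<zero>\<^bsub>C\<^esub>"
  shows "coeff_form f (e g) = f g"
  using assms sg_elem_closed[OF assms(1)]
  by (subst coeff_form_superset[of _ _ "{g}"]) (auto simp: sg_elem_def Pi_def simp del: sg_elem_closed)

text \<open>Multiplication is bilinear, so symmetry under exchange of factors only has to be known
  for two basis elements, where it is f(ab) = f(ba). The condition at the zero covers products that
  vanish in the ring.\<close>

lemma coeff_form_linear_trace:
  assumes f: "f \<in> UNIV \<rightarrow> carrier C" "f (sg_zero G) = \<zero>\<^bsub>C\<^esub>"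
    and comm: "\<And>a b. \<lbrakk>a \<in> carrier G; b \<in> carrier G\<rbrakk> \<Longrightarrow> f (a \<cdot> b) = f (b \<cdot> a)"
  shows "linear_trace C A (self_algebra C) (coeff_form f)"
proof -
  note [simp] = f coeff_form_add coeff_form_smult coeff_form_sg_elem sg_closed sg_elem_mult
    A.m_closed A.l_distr A.r_distr A.smult_mult_left A.smult_mult_right
  \<comment> \<open>The algebra need not have a unit, so absorption by zero is drawn from scaling by
    the zero of C.\<close>
  have lnull: "\<zero>\<^bsub>A\<^esub> \<otimes>\<^bsub>A\<^esub> x = \<zero>\<^bsub>A\<^esub>" and rnull: "x \<otimes>\<^bsub>A\<^esub> \<zero>\<^bsub>A\<^esub> = \<zero>\<^bsub>A\<^esub>" if "x \<in> carrier A" for x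
    using that A.smult_mult_left[of "\<zero>\<^bsub>C\<^esub>" "\<zero>\<^bsub>A\<^esub>" x] A.smult_mult_right[of "\<zero>\<^bsub>C\<^esub>" x "\<zero>\<^bsub>A\<^esub>"]
    by (simp_all del: A.smult_mult_left A.smult_mult_right)
  \<comment> \<open>The extension from pairs of basis elements goes one argument at a time: here one
    factor becomes arbitrary, and the next induction frees the other.\<close>
  have basis: "coeff_form f (x \<otimes>\<^bsub>A\<^esub> e a) = coeff_form f (e a \<otimes>\<^bsub>A\<^esub> x)"
    if "x \<in> carrier A" "a \<in> carrier G" for x a
    using that(1)
  proof (induction x rule: contracted_ring_induct)
    case zero
    then show ?case using that by (simp add: lnull rnull)
  next
    case (add c g x)
    then show ?case using that(2) by (simp add: comm[of g a])
  qed
  have "coeff_form f (x \<otimes>\<^bsub>A\<^esub> y) = coeff_form f (y \<otimes>\<^bsub>A\<^esub> x)" if "x \<in> carrier A" "y \<in> carrier A" for x y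
    using that(2)
  proof (induction y rule: contracted_ring_induct)
    case zero
    then show ?case using that by (simp add: lnull rnull)
  next
    case (add c g y)
    then show ?case using that(1) by (simp add: basis)
  qed
  then show ?thesis
    by (auto simp: linear_trace_def is_trace_def)
qed

definition class_indicator :: "'g set \<Rightarrow> 'g \<Rightarrow> 'c" where
  "class_indicator s g = (if sim_class G g = s then \<one>\<^bsub>C\<^esub> else \<zero>\<^bsub>C\<^esub>)"

lemma class_indicator_closed [simp]: "class_indicator s \<in> UNIV \<rightarrow> carrier C"
  by (simp add: class_indicator_def)

lemma class_indicator_zero: "s \<in> nonzero_classes G \<Longrightarrow> class_indicator s (sg_zero G) = \<zero>\<^bsub>C\<^esub>"
  by (auto simp: class_indicator_def nonzero_classes_eq)

lemma class_trace:
  assumes "s \<in> nonzero_classes G"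
  shows "linear_trace C A (self_algebra C) (coeff_form (class_indicator s))"
  using class_indicator_zero[OF assms]
  by (intro coeff_form_linear_trace) (auto simp: class_indicator_def sim_class_mult_commute)

lemma linear_trace_combination:
  assumes "assoc_algebra C T" "linear_trace C A T t" "finite I" "c \<in> I \<rightarrow> carrier C" "g \<in> I \<rightarrow> carrier G"
  shows "t (\<Oplus>\<^bsub>A\<^esub>i\<in>I. c i \<odot>\<^bsub>A\<^esub> e (g i)) = (\<Oplus>\<^bsub>T\<^esub>i\<in>I. c i \<odot>\<^bsub>T\<^esub> t (e (g i)))"
proof -
  interpret T: assoc_algebra C T by fact
  have t: "t \<in> carrier A \<rightarrow> carrier T"
    "\<And>x y. \<lbrakk>x \<in> carrier A; y \<in> carrier A\<rbrakk> \<Longrightarrow> t (x \<oplus>\<^bsub>A\<^esub> y) = t x \<oplus>\<^bsub>T\<^esub> t y"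
    "\<And>c x. \<lbrakk>c \<in> carrier C; x \<in> carrier A\<rbrakk> \<Longrightarrow> t (c \<odot>\<^bsub>A\<^esub> x) = c \<odot>\<^bsub>T\<^esub> t x"
    using assms(2) by (auto simp: linear_trace_def is_trace_def)
  have "t (\<Oplus>\<^bsub>A\<^esub>i\<in>I. c i \<odot>\<^bsub>A\<^esub> e (g i)) = (\<Oplus>\<^bsub>T\<^esub>i\<in>I. t (c i \<odot>\<^bsub>A\<^esub> e (g i)))"
    using assms(4,5)
    by (intro finsum_hom[where A = A and B = T and t = t] A.M.abelian_group_axioms T.M.abelian_group_axioms t(1,2) assms(3))
      (auto simp: Pi_iff)
  also have "\<dots> = (\<Oplus>\<^bsub>T\<^esub>i\<in>I. c i \<odot>\<^bsub>T\<^esub> t (e (g i)))"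
    using assms(4,5) t(1) by (intro T.finsum_cong') (auto simp: t(3) Pi_def)
  finally show ?thesis .
qed

text \<open>Only the j-th element lies in the class of \<open>g j\<close>, so the indicator of that
  class kills every other term. Applied to a combination in the commutator subgroup, this shows that
  its coefficients vanish.\<close>

lemma class_coefficient:
  assumes "finite I" "c \<in> I \<rightarrow> carrier C" "g \<in> I \<rightarrow> carrier G"
    and "inj_on (\<lambda>i. sim_class G (g i)) I" "j \<in> I" "sim_class G (g j) \<in> nonzero_classes G"
  shows "coeff_form (class_indicator (sim_class G (g j))) (\<Oplus>\<^bsub>A\<^esub>i\<in>I. c i \<odot>\<^bsub>A\<^esub> e (g i)) = c j"
proof -
  let ?f = "class_indicator (sim_class G (g j))"
  have alg: "assoc_algebra C (self_algebra C)"
    using unital_algebra_self_algebra[OF C.is_cring] by (simp add: unital_algebra_def)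
  interpret S: assoc_algebra C "self_algebra C" by (rule alg)
  have "coeff_form ?f (\<Oplus>\<^bsub>A\<^esub>i\<in>I. c i \<odot>\<^bsub>A\<^esub> e (g i)) =
      (\<Oplus>\<^bsub>self_algebra C\<^esub>i\<in>I. c i \<odot>\<^bsub>self_algebra C\<^esub> coeff_form ?f (e (g i)))"
    by (rule linear_trace_combination[OF alg class_trace]) (use assms in auto)
  also have "\<dots> = (\<Oplus>\<^bsub>self_algebra C\<^esub>i\<in>I. if j = i then c i else \<zero>\<^bsub>self_algebra C\<^esub>)"
  proof (rule S.finsum_cong')
    fix i assume i: "i \<in> I"
    then have "coeff_form ?f (e (g i)) = ?f (g i)"
      using assms class_indicator_zero by (intro coeff_form_sg_elem) auto
    then show "c i \<odot>\<^bsub>self_algebra C\<^esub> coeff_form ?f (e (g i)) = (if j = i then c i else \<zero>\<^bsub>self_algebra C\<^esub>)"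
      using assms i by (auto simp: class_indicator_def Pi_def dest: inj_onD)
  qed (use assms in auto)
  also have "\<dots> = c j"
    using assms by (intro S.M.finsum_singleton) auto
  finally show ?thesis .
qed

section \<open>The commutator subgroup and normal forms modulo it\<close>

abbreviation K where "K \<equiv> commutator_subgroup A"

lemma commutator_closed:
  assumes "x \<in> carrier A" "y \<in> carrier A"
  shows "x \<otimes>\<^bsub>A\<^esub> y \<ominus>\<^bsub>A\<^esub> y \<otimes>\<^bsub>A\<^esub> x \<in> K"
  unfolding commutator_subgroup_def using assms by (intro generate.incl) blast

lemma commutator_subgroup_subgroup: "subgroup K (add_monoid A)"
  unfolding commutator_subgroup_def
  by (rule group.generate_is_subgroup[OF A.M.a_group]) (auto simp: A.m_closed)

lemma commutator_subgroup_add: "\<lbrakk>x \<in> K; y \<in> K\<rbrakk> \<Longrightarrow> x \<oplus>\<^bsub>A\<^esub> y \<in> K"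
  using subgroup.m_closed[OF commutator_subgroup_subgroup] by simp

lemma commutator_subgroup_zero: "\<zero>\<^bsub>A\<^esub> \<in> K"
  using subgroup.one_closed[OF commutator_subgroup_subgroup] by simp

lemma commutator_subgroup_carrier: "x \<in> K \<Longrightarrow> x \<in> carrier A"
  using subgroup.subset[OF commutator_subgroup_subgroup] by auto

text \<open>Commutators are killed by symmetry of t, and additivity passes this on to the subgroup
  they generate. A minimal linear trace thus has kernel exactly \<open>K\<close>.\<close>

lemma linear_trace_commutator_subgroup:
  assumes "assoc_algebra C T" "linear_trace C A T t" "x \<in> K"
  shows "t x = \<zero>\<^bsub>T\<^esub>"
proof -
  interpret T: assoc_algebra C T by fact
  have t: "t x \<in> carrier T" if "x \<in> carrier A" for x
    using assms(2) that by (auto simp: linear_trace_def is_trace_def)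
  have t_add: "t (x \<oplus>\<^bsub>A\<^esub> y) = t x \<oplus>\<^bsub>T\<^esub> t y"
    and t_mult: "t (x \<otimes>\<^bsub>A\<^esub> y) = t (y \<otimes>\<^bsub>A\<^esub> x)" if "x \<in> carrier A" "y \<in> carrier A" for x y
    using assms(2) that by (auto simp: linear_trace_def is_trace_def)
  have t_hom: "group_hom (add_monoid A) (add_monoid T) t"
    by (intro group_hom.intro group_hom_axioms.intro A.M.a_group T.M.a_group homI)
      (auto simp: t t_add)
  have t_inv: "t (\<ominus>\<^bsub>A\<^esub> x) = \<ominus>\<^bsub>T\<^esub> t x" if "x \<in> carrier A" for x
    using group_hom.hom_inv[OF t_hom, of x] that by (simp add: a_inv_def)
  have comm0: "t (x \<otimes>\<^bsub>A\<^esub> y \<ominus>\<^bsub>A\<^esub> y \<otimes>\<^bsub>A\<^esub> x) = \<zero>\<^bsub>T\<^esub>" if "x \<in> carrier A" "y \<in> carrier A" for x y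
    using that by (simp add: a_minus_def t_add t_inv t_mult[of x y] A.m_closed t T.M.r_neg)
  show ?thesis
    using assms(3) unfolding commutator_subgroup_def
  proof (induction rule: generate.induct)
    case one
    then show ?case using group_hom.hom_one[OF t_hom] by simp
  next
    case (incl h)
    then show ?case by (auto simp: comm0)
  next
    case (inv h)
    then show ?case
      by (auto simp: comm0 t_inv A.m_closed simp flip: a_inv_def)
  next
    case (eng h1 h2)
    then have "h1 \<in> carrier A" "h2 \<in> carrier A"
      using commutator_subgroup_carrier[unfolded commutator_subgroup_def] by blast+
    then show ?case using eng.IH by (simp add: t_add)
  qed
qed

text \<open>Along a chain of swaps the differences telescope, so a single swap is what matters.
  Membership of h in G is carried through the induction to keep the intermediate terms in the
  ring.\<close>

lemma sim_diff_commutator_subgroup: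
  assumes "(g, h) \<in> sim G" "c \<in> carrier C"
  shows "c \<odot>\<^bsub>A\<^esub> e g \<ominus>\<^bsub>A\<^esub> c \<odot>\<^bsub>A\<^esub> e h \<in> K"
proof -
  have "(g, h) \<in> (swap_step G)\<^sup>*" "g \<in> carrier G"
    using assms by (auto simp: sim_def)
  then have "h \<in> carrier G \<and> c \<odot>\<^bsub>A\<^esub> e g \<ominus>\<^bsub>A\<^esub> c \<odot>\<^bsub>A\<^esub> e h \<in> K"
  proof (induction rule: rtrancl_induct)
    case base
    then show ?case
      using assms by (simp add: a_minus_def A.M.r_neg commutator_subgroup_zero)
  next
    case (step h k)
    then obtain a b where ab: "a \<in> carrier G" "b \<in> carrier G" "h = a \<cdot> b" "k = b \<cdot> a"
      by (auto simp: swap_step_def)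
    \<comment> \<open>The scalar goes into the factor \<open>e a\<close>, which makes the scaled
      difference one commutator.\<close>
    have "(c \<odot>\<^bsub>A\<^esub> e a) \<otimes>\<^bsub>A\<^esub> e b \<ominus>\<^bsub>A\<^esub> e b \<otimes>\<^bsub>A\<^esub> (c \<odot>\<^bsub>A\<^esub> e a) \<in> K"
      using ab assms by (intro commutator_closed) auto
    then have "c \<odot>\<^bsub>A\<^esub> e h \<ominus>\<^bsub>A\<^esub> c \<odot>\<^bsub>A\<^esub> e k \<in> K"
      using ab assms by (simp add: A.smult_mult_left A.smult_mult_right sg_elem_mult)
    with step have "(c \<odot>\<^bsub>A\<^esub> e g \<ominus>\<^bsub>A\<^esub> c \<odot>\<^bsub>A\<^esub> e h) \<oplus>\<^bsub>A\<^esub> (c \<odot>\<^bsub>A\<^esub> e h \<ominus>\<^bsub>A\<^esub> c \<odot>\<^bsub>A\<^esub> e k) \<in> K"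
      by (intro commutator_subgroup_add) auto
    moreover have "(c \<odot>\<^bsub>A\<^esub> e g \<ominus>\<^bsub>A\<^esub> c \<odot>\<^bsub>A\<^esub> e h) \<oplus>\<^bsub>A\<^esub> (c \<odot>\<^bsub>A\<^esub> e h \<ominus>\<^bsub>A\<^esub> c \<odot>\<^bsub>A\<^esub> e k) =
        c \<odot>\<^bsub>A\<^esub> e g \<ominus>\<^bsub>A\<^esub> c \<odot>\<^bsub>A\<^esub> e k" (is "(?u \<ominus>\<^bsub>A\<^esub> ?v) \<oplus>\<^bsub>A\<^esub> (?v \<ominus>\<^bsub>A\<^esub> ?w) = _")
    proof -
      have "?u \<in> carrier A" "?v \<in> carrier A" "?w \<in> carrier A"
        using step ab assms(2) by (auto simp: sg_closed)
      then show ?thesis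
        by (simp add: a_minus_def A.M.a_assoc A.M.r_neg1)
    qed
    ultimately show ?case
      using ab by (simp add: sg_closed)
  qed
  then show ?thesis by blast
qed

text \<open>Each basis element is traded for its representative at the cost of an element of
  \<open>K\<close>. Several terms may land on the same representative and cancel, so only an
  inclusion of the support is claimed.\<close>

lemma representative_form:
  assumes "x \<in> carrier A" and r: "r \<in> carrier G \<rightarrow> carrier G"
    "\<And>g. g \<in> carrier G \<Longrightarrow> sim_class G (r g) = sim_class G g"
  shows "\<exists>y\<in>carrier A. {g. y g \<noteq> \<zero>\<^bsub>C\<^esub>} \<subseteq> r ` carrier G \<and> x \<ominus>\<^bsub>A\<^esub> y \<in> K"
  using assms(1)
proof (induction x rule: contracted_ring_induct)
  case zero
  have "\<zero>\<^bsub>A\<^esub> \<ominus>\<^bsub>A\<^esub> \<zero>\<^bsub>A\<^esub> \<in> K"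
    by (simp add: a_minus_def A.M.r_neg commutator_subgroup_zero)
  then show ?case
    using A.M.zero_closed by (intro bexI[of _ "\<zero>\<^bsub>A\<^esub>"]) (simp_all add: contracted_ring_simps(3))
next
  case (add c g x)
  then obtain y where y: "y \<in> carrier A" "{g. y g \<noteq> \<zero>\<^bsub>C\<^esub>} \<subseteq> r ` carrier G" "x \<ominus>\<^bsub>A\<^esub> y \<in> K"
    by blast
  have rg: "r g \<in> carrier G" "(g, r g) \<in> sim G"
    using add r sim_class_eq_iff[of g "r g"] by auto
  let ?u = "c \<odot>\<^bsub>A\<^esub> e g" and ?v = "c \<odot>\<^bsub>A\<^esub> e (r g)"
  have uv: "?u \<in> carrier A" "?v \<in> carrier A"
    using add rg by auto
  have "(?u \<ominus>\<^bsub>A\<^esub> ?v) \<oplus>\<^bsub>A\<^esub> (x \<ominus>\<^bsub>A\<^esub> y) \<in> K"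
    using y(3) sim_diff_commutator_subgroup[OF rg(2) add(1)] by (rule commutator_subgroup_add[rotated])
  moreover have "(?u \<ominus>\<^bsub>A\<^esub> ?v) \<oplus>\<^bsub>A\<^esub> (x \<ominus>\<^bsub>A\<^esub> y) = (?u \<oplus>\<^bsub>A\<^esub> x) \<ominus>\<^bsub>A\<^esub> (?v \<oplus>\<^bsub>A\<^esub> y)"
    using uv y(1) add(3) by (simp add: a_minus_def A.M.minus_add A.M.a_ac)
  moreover have "{h. (?v \<oplus>\<^bsub>A\<^esub> y) h \<noteq> \<zero>\<^bsub>C\<^esub>} \<subseteq> r ` carrier G"
  proof
    fix h assume "h \<in> {h. (?v \<oplus>\<^bsub>A\<^esub> y) h \<noteq> \<zero>\<^bsub>C\<^esub>}"
    then have "h = r g \<or> y h \<noteq> \<zero>\<^bsub>C\<^esub>"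
      using add(1) by (auto simp: sg_elem_def contracted_ring_simps split: if_splits)
    then show "h \<in> r ` carrier G"
      using y(2) add(2) by auto
  qed
  ultimately show ?case
    using uv y(1) by (intro bexI[of _ "?v \<oplus>\<^bsub>A\<^esub> y"]) (auto)
qed

section \<open>The criterion for minimality\<close>

abbreviation class_family :: "nat \<Rightarrow> (nat \<Rightarrow> 'g) \<Rightarrow> bool" where
  "class_family n g \<equiv> (\<forall>i\<in>{1..n}. g i \<in> carrier G \<and> sim_class G (g i) \<in> nonzero_classes G) \<and>
     inj_on (\<lambda>i. sim_class G (g i)) {1..n}"

text \<open>For independence, a relation among the values lifts to an element of the kernel, hence
  of \<open>K\<close>, and class functionals read off its coefficients. Conversely, a kernel element
  is replaced by its normal form, whose coefficients then satisfy a relation among the values and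
  must vanish.\<close>

lemma minimal_trace_iff:
  assumes "assoc_algebra C T" "linear_trace C A T t"
  shows "minimal_trace A T t \<longleftrightarrow>
    (\<forall>n g. class_family n g \<longrightarrow> lin_indep_family C T {1..n} (\<lambda>i. t (e (g i))))"
    (is "_ = ?indep")
proof
  assume min: "minimal_trace A T t"
  show ?indep
  proof (intro allI impI)
    fix n and g :: "nat \<Rightarrow> 'g"
    assume fam: "class_family n g"
    show "lin_indep_family C T {1..n} (\<lambda>i. t (e (g i)))"
      unfolding lin_indep_family_def
    proof (intro ballI impI)
      fix c j
      assume c: "c \<in> {1..n} \<rightarrow> carrier C" and j: "j \<in> {1..n}"
        and 0: "(\<Oplus>\<^bsub>T\<^esub>i\<in>{1..n}. c i \<odot>\<^bsub>T\<^esub> t (e (g i))) = \<zero>\<^bsub>T\<^esub>"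
      let ?x = "\<Oplus>\<^bsub>A\<^esub>i\<in>{1..n}. c i \<odot>\<^bsub>A\<^esub> e (g i)"
      have g: "g \<in> {1..n} \<rightarrow> carrier G"
        using fam by auto
      have "t ?x = \<zero>\<^bsub>T\<^esub>"
        using linear_trace_combination[OF assms _ c g] 0 by simp
      moreover have "?x \<in> carrier A"
        using c g by (auto intro!: A.M.finsum_closed simp: Pi_iff)
      ultimately have "?x \<in> K"
        using min by (simp add: minimal_trace_def)
      then have "coeff_form (class_indicator (sim_class G (g j))) ?x = \<zero>\<^bsub>self_algebra C\<^esub>"
        using fam j unital_algebra_self_algebra[OF C.is_cring]
        by (intro linear_trace_commutator_subgroup[OF _ class_trace]) (auto simp: unital_algebra_def)
      then show "c j = \<zero>\<^bsub>C\<^esub>"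
        using class_coefficient[OF _ c g _ j] fam j by simp
    qed
  qed
next
  assume indep: ?indep
  interpret T: assoc_algebra C T by fact
  have "x \<in> K" if x: "x \<in> carrier A" "t x = \<zero>\<^bsub>T\<^esub>" for x
  proof -
    obtain r where r: "r \<in> carrier G \<rightarrow> carrier G"
      "\<And>g. g \<in> carrier G \<Longrightarrow> sim_class G (r g) = sim_class G g"
      "\<And>g h. sim_class G g = sim_class G h \<Longrightarrow> r g = r h" "r (sg_zero G) = sg_zero G"
      using class_representatives by metis
    obtain y where y: "y \<in> carrier A" "{g. y g \<noteq> \<zero>\<^bsub>C\<^esub>} \<subseteq> r ` carrier G" "x \<ominus>\<^bsub>A\<^esub> y \<in> K"
      using representative_form[OF x(1) r(1,2)] by blast
    define U where "U = {g. y g \<noteq> \<zero>\<^bsub>C\<^esub>}"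
    have U: "finite U" "U \<subseteq> carrier G - {sg_zero G}"
      using y(1) by (auto simp: U_def contracted_ring_carrier)
    obtain b where b: "bij_betw b {1..card U} U"
      using ex_bij_betw_nat_finite_1[OF U(1)] by blast
    have fam: "class_family (card U) b"
    proof (intro conjI ballI)
      fix i assume "i \<in> {1..card U}"
      then have bi: "b i \<in> U" using b by (auto dest: bij_betwE)
      then show "b i \<in> carrier G" using U by auto
      obtain g where g: "g \<in> carrier G" "b i = r g"
        using bi y(2) by (auto simp: U_def)
      \<comment> \<open>Otherwise \<open>r g\<close> would equal the representative of [0], which is
        the zero of G, but supports avoid the zero.\<close>
      have "sim_class G g \<noteq> sim_class G (sg_zero G)"
        using r(3)[of g "sg_zero G"] r(4) g bi U(2) by auto
      then show "sim_class G (b i) \<in> nonzero_classes G"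
        using g r(2) by (auto simp: nonzero_classes_eq)
    next
      show "inj_on (\<lambda>i. sim_class G (b i)) {1..card U}"
      proof (rule inj_onI)
        fix i j assume ij: "i \<in> {1..card U}" "j \<in> {1..card U}" "sim_class G (b i) = sim_class G (b j)"
        obtain g where g: "g \<in> carrier G" "b i = r g"
          using bij_betwE[OF b] ij y(2) unfolding U_def by blast
        obtain h where h: "h \<in> carrier G" "b j = r h"
          using bij_betwE[OF b] ij y(2) unfolding U_def by blast
        \<comment> \<open>The elements listed are values of r, which is constant on classes and
          stays within them, so equal classes force equal representatives.\<close>
        have "b i = b j"
          using r(2,3) g h ij by metis
        then show "i = j"
          using b ij by (auto simp: bij_betw_def dest: inj_onD)
      qed
    qed
    have yb: "(\<lambda>i. y (b i)) \<in> {1..card U} \<rightarrow> carrier C" and bG: "b \<in> {1..card U} \<rightarrow> carrier G"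
      using y(1) fam by auto
    have "y = (\<Oplus>\<^bsub>A\<^esub>g\<in>U. y g \<odot>\<^bsub>A\<^esub> e g)"
      using y(1) U by (intro decomposition) (auto simp: U_def)
    also have "\<dots> = (\<Oplus>\<^bsub>A\<^esub>g\<in>b ` {1..card U}. y g \<odot>\<^bsub>A\<^esub> e g)"
      using b by (simp add: bij_betw_def)
    also have "\<dots> = (\<Oplus>\<^bsub>A\<^esub>i\<in>{1..card U}. y (b i) \<odot>\<^bsub>A\<^esub> e (b i))"
      using b y(1) U by (intro A.M.finsum_reindex) (auto simp: bij_betw_def)
    finally have y_sum: "y = \<dots>" .
    \<comment> \<open>x and y differ by an element of \<open>K\<close>, on which t vanishes.\<close>
    have "t y = \<zero>\<^bsub>T\<^esub>"
    proof -
      have "t ((x \<ominus>\<^bsub>A\<^esub> y) \<oplus>\<^bsub>A\<^esub> y) = t (x \<ominus>\<^bsub>A\<^esub> y) \<oplus>\<^bsub>T\<^esub> t y"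
        using assms(2) x y(1) by (simp add: linear_trace_def is_trace_def)
      moreover have "(x \<ominus>\<^bsub>A\<^esub> y) \<oplus>\<^bsub>A\<^esub> y = x"
        using x y(1) by (simp add: a_minus_def A.M.a_assoc A.M.l_neg)
      moreover have "t y \<in> carrier T"
        using assms(2) y(1) by (auto simp: linear_trace_def is_trace_def)
      ultimately show ?thesis
        using linear_trace_commutator_subgroup[OF assms y(3)] x(2) by simp
    qed
    then have comb: "(\<Oplus>\<^bsub>T\<^esub>i\<in>{1..card U}. y (b i) \<odot>\<^bsub>T\<^esub> t (e (b i))) = \<zero>\<^bsub>T\<^esub>"
      using linear_trace_combination[OF assms _ yb bG] y_sum by simp
    have "lin_indep_family C T {1..card U} (\<lambda>i. t (e (b i)))"
      using indep fam by blast
    from this[unfolded lin_indep_family_def, THEN bspec, OF yb, rule_format, OF comb]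
    have "\<forall>i\<in>{1..card U}. y (b i) = \<zero>\<^bsub>C\<^esub>"
      by blast
    then have "y g = \<zero>\<^bsub>C\<^esub>" if "g \<in> U" for g
      using that bij_betw_imp_surj_on[OF b] by (metis imageE)
    then have "U = {}"
      by (auto simp: U_def)
    then have "y = \<zero>\<^bsub>A\<^esub>"
      by (auto simp: U_def contracted_ring_simps)
    moreover have "x \<ominus>\<^bsub>A\<^esub> \<zero>\<^bsub>A\<^esub> = x"
      using x(1) A.M.r_neg[of "\<zero>\<^bsub>A\<^esub>"] by (simp add: a_minus_def)
    ultimately show ?thesis
      using y(3) by metis
  qed
  then show "minimal_trace A T t"
    using assms(2) by (auto simp: minimal_trace_def linear_trace_def)
qed

section \<open>The trace into the direct sum\<close>

text \<open>The component at s is the functional of the class s. In the criterion, a relation among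
  the values is evaluated at the coordinate [g j] to isolate c j.\<close>

lemma minimal_trace_direct_sum:
  "\<exists>t. linear_trace C A (direct_sum_copies C (nonzero_classes G)) t \<and>
    minimal_trace A (direct_sum_copies C (nonzero_classes G)) t"
proof -
  let ?S = "nonzero_classes G" and ?D = "direct_sum_copies C (nonzero_classes G)"
  define t where "t x s = (if s \<in> ?S then coeff_form (class_indicator s) x else \<zero>\<^bsub>C\<^esub>)" for x s
  have alg: "assoc_algebra C ?D"
    by (rule assoc_algebra_direct_sum_copies) (rule C.is_cring)
  have "t x \<in> carrier ?D" if "x \<in> carrier A" for x
  proof -
    \<comment> \<open>A class that misses the support of x contributes only zero terms, which bounds
      the support of t x by a finite set.\<close>
    have "{s. t x s \<noteq> \<zero>\<^bsub>C\<^esub>} \<subseteq> sim_class G ` {g. x g \<noteq> \<zero>\<^bsub>C\<^esub>}"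
    proof (rule ccontr)
      assume "\<not> ?thesis"
      then obtain s where s: "t x s \<noteq> \<zero>\<^bsub>C\<^esub>" "s \<notin> sim_class G ` {g. x g \<noteq> \<zero>\<^bsub>C\<^esub>}"
        by blast
      then have "coeff_form (class_indicator s) x = \<zero>\<^bsub>C\<^esub>"
        unfolding coeff_form_def using that
        by (intro C.add.finprod_one_eqI) (auto simp: class_indicator_def)
      with s show False by (simp add: t_def split: if_splits)
    qed
    then have "finite {s. t x s \<noteq> \<zero>\<^bsub>C\<^esub>}"
      using finite_support[OF that] by (rule finite_surj[rotated])
    then show ?thesis
      using that by (auto simp: direct_sum_copies_def t_def)
  qed
  moreover have "t (x \<oplus>\<^bsub>A\<^esub> y) = t x \<oplus>\<^bsub>?D\<^esub> t y" "t (x \<otimes>\<^bsub>A\<^esub> y) = t (y \<otimes>\<^bsub>A\<^esub> x)"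
    if "x \<in> carrier A" "y \<in> carrier A" for x y
    using that class_trace
    by (auto simp: t_def fun_eq_iff direct_sum_copies_simps coeff_form_add linear_trace_def is_trace_def)
  moreover have "t (c \<odot>\<^bsub>A\<^esub> x) = c \<odot>\<^bsub>?D\<^esub> t x" if "c \<in> carrier C" "x \<in> carrier A" for c x
    using that by (auto simp: t_def fun_eq_iff direct_sum_copies_simps coeff_form_smult)
  ultimately have trace: "linear_trace C A ?D t"
    by (simp add: linear_trace_def is_trace_def Pi_def)
  have "lin_indep_family C ?D {1..n} (\<lambda>i. t (e (g i)))" if fam: "class_family n g" for n g
    unfolding lin_indep_family_def
  proof (intro ballI impI)
    fix c j
    assume c: "c \<in> {1..n} \<rightarrow> carrier C" and j: "j \<in> {1..n}"
      and 0: "(\<Oplus>\<^bsub>?D\<^esub>i\<in>{1..n}. c i \<odot>\<^bsub>?D\<^esub> t (e (g i))) = \<zero>\<^bsub>?D\<^esub>"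
    have g: "g \<in> {1..n} \<rightarrow> carrier G"
      using fam by auto
    have "t (\<Oplus>\<^bsub>A\<^esub>i\<in>{1..n}. c i \<odot>\<^bsub>A\<^esub> e (g i)) = \<zero>\<^bsub>?D\<^esub>"
      using linear_trace_combination[OF alg trace _ c g] 0 by simp
    from fun_cong[OF this, of "sim_class G (g j)"] show "c j = \<zero>\<^bsub>C\<^esub>"
      using class_coefficient[OF _ c g _ j] fam j by (simp add: t_def direct_sum_copies_simps)
  qed
  then have "minimal_trace A ?D t"
    using minimal_trace_iff[OF alg trace] by blast
  with trace show ?thesis by blast
qed

section \<open>Normalized minimal traces\<close>

lemma normalized_minimal_trace_self_algebra:
  assumes "finite (nonzero_classes G)" "card (nonzero_classes G) \<le> 1"
  shows "\<exists>t. normalized_minimal_trace C G (self_algebra C) t"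
proof -
  let ?S = "nonzero_classes G"
  \<comment> \<open>On G this is the indicator of the complement of [0]. With at most one nonzero
    class it is the indicator of that class, or zero, so one functional with values in C already
    separates the classes.\<close>
  define f where "f g = (if sim_class G g \<in> ?S then \<one>\<^bsub>C\<^esub> else \<zero>\<^bsub>C\<^esub>)" for g
  have alg: "unital_algebra C (self_algebra C)" "assoc_algebra C (self_algebra C)"
    using unital_algebra_self_algebra[OF C.is_cring] by (auto simp: unital_algebra_def)
  interpret S: assoc_algebra C "self_algebra C" by (rule alg)
  have f: "f \<in> UNIV \<rightarrow> carrier C" "f (sg_zero G) = \<zero>\<^bsub>C\<^esub>"
    by (auto simp: f_def nonzero_classes_eq)
  have trace: "linear_trace C A (self_algebra C) (coeff_form f)"
    by (rule coeff_form_linear_trace[OF f]) (simp add: f_def sim_class_mult_commute)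
  have form_eq: "coeff_form f (e g) = f g" if "g \<in> carrier G" for g
    using that f by (rule coeff_form_sg_elem)
  have "lin_indep_family C (self_algebra C) {1..n} (\<lambda>i. coeff_form f (e (g i)))"
    if fam: "class_family n g" for n g
    unfolding lin_indep_family_def
  proof (intro ballI impI)
    fix c j
    assume c: "c \<in> {1..n} \<rightarrow> carrier C" and j: "j \<in> {1..n}"
      and 0: "(\<Oplus>\<^bsub>self_algebra C\<^esub>i\<in>{1..n}. c i \<odot>\<^bsub>self_algebra C\<^esub> coeff_form f (e (g i))) =
        \<zero>\<^bsub>self_algebra C\<^esub>"
    \<comment> \<open>A family of distinct nonzero classes has at most one member here, so a
      relation has the single term c j times 1.\<close>
    have "card {1..n} \<le> card ?S"
      using fam assms(1) by (intro card_inj_on_le[of "\<lambda>i. sim_class G (g i)"]) auto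
    with assms(2) j have "{1..n} = {j}"
      by auto
    then have "c j \<otimes>\<^bsub>C\<^esub> f (g j) = \<zero>\<^bsub>C\<^esub>" "c j \<in> carrier C" "f (g j) = \<one>\<^bsub>C\<^esub>"
      using 0 c fam f by (auto simp: form_eq f_def)
    then show "c j = \<zero>\<^bsub>C\<^esub>"
      by simp
  qed
  then have "minimal_trace A (self_algebra C) (coeff_form f)"
    using minimal_trace_iff[OF alg(2) trace] by blast
  moreover have "normalized_trace C G (self_algebra C) (coeff_form f)"
    using trace by (auto simp: normalized_trace_def form_eq f_def)
  ultimately show ?thesis
    using alg(1) by (auto simp: normalized_minimal_trace_def)
qed

text \<open>Two values taken from 0 and 1 are always dependent over a nontrivial C, so the criterion
  rules out two distinct nonzero classes. Finiteness is asserted separately because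
  \<open>card\<close> of an infinite set is 0.\<close>

lemma normalized_minimal_trace_classes:
  assumes "\<one>\<^bsub>C\<^esub> \<noteq> \<zero>\<^bsub>C\<^esub>" "normalized_minimal_trace C G T t"
  shows "finite (nonzero_classes G) \<and> card (nonzero_classes G) \<le> 1"
proof -
  have alg: "assoc_algebra C T" and "ring T" and trace: "linear_trace C A T t"
    and min: "minimal_trace A T t"
    and t01: "\<And>g. g \<in> carrier G \<Longrightarrow> t (e g) \<in> {\<zero>\<^bsub>T\<^esub>, \<one>\<^bsub>T\<^esub>}"
    using assms(2)
    by (auto simp: normalized_minimal_trace_def unital_algebra_def normalized_trace_def)
  interpret T: assoc_algebra C T by fact
  interpret TR: ring T by fact
  have eq: "sim_class G g = sim_class G h"
    if gh: "g \<in> carrier G" "h \<in> carrier G" "sim_class G g \<in> nonzero_classes G"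
      "sim_class G h \<in> nonzero_classes G" for g h
  proof (rule ccontr)
    assume "sim_class G g \<noteq> sim_class G h"
    let ?g = "\<lambda>i. if i = (1::nat) then g else h"
    have two: "{Suc 0..2} = {Suc 0, 2}" by auto
    have "class_family 2 ?g"
      using gh \<open>sim_class G g \<noteq> sim_class G h\<close> by (auto simp: two inj_on_def)
    then have "lin_indep_family C T {1..2} (\<lambda>i. t (e (?g i)))"
      using minimal_trace_iff[OF alg trace, THEN iffD1, OF min, rule_format, of 2 ?g] by simp
    moreover have "(\<Oplus>\<^bsub>T\<^esub>i\<in>{1..2}. c i \<odot>\<^bsub>T\<^esub> t (e (?g i))) = c 1 \<odot>\<^bsub>T\<^esub> t (e g) \<oplus>\<^bsub>T\<^esub> c 2 \<odot>\<^bsub>T\<^esub> t (e h)"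
      if "c \<in> {1..2} \<rightarrow> carrier C" for c
      using that t01[OF gh(1)] t01[OF gh(2)] by (auto simp: two)
    ultimately have indep: "c 1 = \<zero>\<^bsub>C\<^esub> \<and> c 2 = \<zero>\<^bsub>C\<^esub>"
      if "c \<in> {1..2} \<rightarrow> carrier C" "c 1 \<odot>\<^bsub>T\<^esub> t (e g) \<oplus>\<^bsub>T\<^esub> c 2 \<odot>\<^bsub>T\<^esub> t (e h) = \<zero>\<^bsub>T\<^esub>" for c :: "nat \<Rightarrow> 'c"
      using that unfolding lin_indep_family_def by (auto simp: two)
    \<comment> \<open>The coefficient pairs refuting independence are (1, 0), (0, 1) and (1, -1);
      each has the first or second entry 1, which differs from 0 in C.\<close>
    consider "t (e g) = \<zero>\<^bsub>T\<^esub>" | "t (e h) = \<zero>\<^bsub>T\<^esub>" | "t (e g) = \<one>\<^bsub>T\<^esub>" "t (e h) = \<one>\<^bsub>T\<^esub>"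
      using t01 gh by blast
    then show False
    proof cases
      case 1
      then show False
        using indep[of "\<lambda>i. if i = 1 then \<one>\<^bsub>C\<^esub> else \<zero>\<^bsub>C\<^esub>"] assms(1) t01[OF gh(2)] by auto
    next
      case 2
      then show False
        using indep[of "\<lambda>i. if i = 1 then \<zero>\<^bsub>C\<^esub> else \<one>\<^bsub>C\<^esub>"] assms(1) t01[OF gh(1)] by auto
    next
      case 3
      then show False
        using indep[of "\<lambda>i. if i = 1 then \<one>\<^bsub>C\<^esub> else \<ominus>\<^bsub>C\<^esub> \<one>\<^bsub>C\<^esub>"] assms(1)
        by (auto simp: T.smult_l_minus T.M.r_neg)
    qed
  qed
  have "s = s'" if "s \<in> nonzero_classes G" "s' \<in> nonzero_classes G" for s s'
    using that eq unfolding nonzero_classes_eq by blast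
  then obtain s where "nonzero_classes G \<subseteq> {s}"
    by (cases "nonzero_classes G = {}") blast+
  then show ?thesis
    using finite_subset[of _ "{s}"] card_mono[of "{s}"] by simp
qed

end

theorem theorem11:
  fixes C :: "'c ring" and G :: "'g zero_semigroup"
  assumes "cring C" and "\<one>\<^bsub>C\<^esub> \<noteq> \<zero>\<^bsub>C\<^esub>" and "semigroup_with_zero G"
  shows
    "(\<exists>t. linear_trace C (contracted_ring C G) (direct_sum_copies C (nonzero_classes G)) t \<and>
          minimal_trace (contracted_ring C G) (direct_sum_copies C (nonzero_classes G)) t) \<and>
     (\<forall>(R :: ('c, 'r) module) t.
        assoc_algebra C R \<and> linear_trace C (contracted_ring C G) R t \<longrightarrow>
        (minimal_trace (contracted_ring C G) R t \<longleftrightarrow>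
          (\<forall>(n::nat) g.
             (\<forall>i\<in>{1..n}. g i \<in> carrier G \<and> sim_class G (g i) \<in> nonzero_classes G) \<and>
             inj_on (\<lambda>i. sim_class G (g i)) {1..n} \<longrightarrow>
             lin_indep_family C R {1..n} (\<lambda>i. t (sg_elem C G (g i)))))) \<and>
     ((\<exists>(R :: ('c, 'c) module) t. normalized_minimal_trace C G R t)
        \<longleftrightarrow> finite (nonzero_classes G) \<and> card (nonzero_classes G) \<le> 1) \<and>
     (\<forall>(R :: ('c, 'r) module) t. normalized_minimal_trace C G R t
        \<longrightarrow> finite (nonzero_classes G) \<and> card (nonzero_classes G) \<le> 1)"
proof -
  interpret contracted_semigroup_ring C G
    using assms by (simp add: contracted_semigroup_ring_def)
  show ?thesis
  \<comment> \<open>The instantiated rules split only the four outer conjuncts and leave the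
    conjunction of finiteness and the cardinality bound whole.\<close>
  proof (intro conjI[of "Ex _"] conjI[of "All _"] conjI[of "_ \<longleftrightarrow> _"] allI impI)
    show "\<exists>t. linear_trace C A (direct_sum_copies C (nonzero_classes G)) t \<and>
        minimal_trace A (direct_sum_copies C (nonzero_classes G)) t"
      by (rule minimal_trace_direct_sum)
  next
    fix R :: "('c, 'r) module" and t
    assume "assoc_algebra C R \<and> linear_trace C A R t"
    then show "minimal_trace A R t \<longleftrightarrow>
        (\<forall>n g. class_family n g \<longrightarrow> lin_indep_family C R {1..n} (\<lambda>i. t (e (g i))))"
      using minimal_trace_iff by blast
  next
    show "(\<exists>(R :: ('c, 'c) module) t. normalized_minimal_trace C G R t) \<longleftrightarrow>
        finite (nonzero_classes G) \<and> card (nonzero_classes G) \<le> 1"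
      using normalized_minimal_trace_self_algebra normalized_minimal_trace_classes[OF assms(2)] by blast
  next
    fix R :: "('c, 'r) module" and t
    assume "normalized_minimal_trace C G R t"
    then show "finite (nonzero_classes G) \<and> card (nonzero_classes G) \<le> 1"
      by (rule normalized_minimal_trace_classes[OF assms(2)])
  qed
qed

end
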